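(* Let $f:\mathbb{R}^d\to\mathbb{R}$ be $\mu$-strongly convex and $L$-smooth and consider the noisy GMM iterations with Gaussian gradient noise, with the parameters $(\alpha,\beta,\gamma)=(\alpha_{\vartheta,\psi},\beta_{\vartheta,\psi},\gamma_{\vartheta,\psi})$, $(\vartheta,\psi)\in\mathcal{S}_0\cup\mathcal{S}_c$, described in the context; write $\alpha,\beta,\gamma$ for these parameters. Let $\varphi\in(0,1)$ be a fixed constant and $\zeta\in(0,1)$ a confidence level. With $\mathtt v$ and $\theta_u^g$ as in the context, set $\theta_\varphi^g=\varphi\theta_u^g$ and $$\bar{\bar\rho}^{(\varphi)}=\frac12\left(1-\sqrt{\vartheta\alpha\mu}+\frac{4\theta_\varphi^g\alpha^2\mathtt v}{2-\theta_\varphi^g\alpha(\vartheta+\alpha L)}\right)+\frac12\sqrt{\left(1-\sqrt{\vartheta\alpha\mu}+\frac{4\theta_\varphi^g\alpha^2\mathtt v}{2-\theta_\varphi^g\alpha(\vartheta+\alpha L)}\right)^2+\frac{16\theta_\varphi^g\alpha^2\mathtt v}{2-\theta_\varphi^g\alpha(\vartheta+\alpha L)}}.$$ Consider the condition $$(\ast)\qquad\log\left(\frac1\zeta\right)\le\frac{d}{2(1-\bar{\bar\rho}^{(\varphi)})}\left(\frac{\theta_\varphi^g\alpha(\vartheta+\alpha L)}{2-\theta_\varphi^g\alpha(\vartheta+\alpha L)}\right)^2.$$ If $(\ast)$ holds, then for every $k\ge1$ $$\mathrm{EV@R}_{1-\zeta}[f(x_k)-f(x_* )]\le\frac{\sigma^2\alpha(\vartheta+\alpha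 L)}{2}\left(\sqrt{\frac{d}{1-\bar{\bar\rho}^{(\varphi)}}}+\sqrt{2\log(1/\zeta)}\right)^2+(\bar{\bar\rho}^{(\varphi)})^k\,2\mathcal{V}_P(z_0).$$ If $(\ast)$ does not hold, then for every $k\ge1$ $$\mathrm{EV@R}_{1-\zeta}[f(x_k)-f(x_* )]\le\frac{\sigma^2d\,\alpha(\vartheta+\alpha L)}{(1-\bar{\bar\rho}^{(\varphi)})\left(2-\theta_\varphi^g\alpha(\vartheta+\alpha L)\right)}+\frac{2\sigma^2}{\theta_\varphi^g}\log(1/\zeta)+(\bar{\bar\rho}^{(\varphi)})^k\,2\mathcal{V}_P(z_0).$$ Moreover, $$\limsup_{k\to\infty}\mathrm{EV@R}_{1-\zeta}[f(x_k)-f(x_* )]\le\bar E_{1-\zeta}:=\begin{cases}\dfrac{\sigma^2\alpha(\vartheta+\alpha L)}{2}\left(\sqrt{\dfrac{d}{1-\bar{\bar\rho}^{(\varphi)}}}+\sqrt{2\log(1/\zeta)}\right)^2,&\text{if }(\ast)\text{ holds},\\[3mm]\dfrac{\sigma^2d\,\alpha(\vartheta+\alpha L)}{(1-\bar{\bar\rho}^{(\varphi)})\left(2-\theta_\varphi^g\alpha(\vartheta+\alpha L)\right)}+\dfrac{2\sigma^2}{\theta_\varphi^g}\log(1/\zeta),&\text{otherwise.}\end{cases}$$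
   Context: $0<\mu<L$, $\kappa=L/\mu$, $x_*$ is the unique minimizer of $f$. The noisy generalized momentum method (GMM) with parameters $(\alpha,\beta,\gamma)$ and deterministic initialization $x_0,x_{-1}\in\mathbb{R}^d$ is $$x_{k+1}=(1+\beta)x_k-\beta x_{k-1}-\alpha\left(\nabla f(y_k)+w_{k+1}\right),\qquad y_k=(1+\gamma)x_k-\gamma x_{k-1},\qquad k\ge0.$$ Noise assumption: for each $k$, $w_{k+1}\sim\mathcal{N}(0,\sigma^2I_d)$ for some $\sigma>0$, and $w_{k+1}$ is independent of the $\sigma$-algebra $\mathcal{F}_k$ generated by $x_0,\dots,x_k$. Put $z_k=[x_k^\top,x_{k-1}^\top]^\top$, $z_*=[x_*^\top,x_*^\top]^\top$. Parameter choice. Let $\mathcal{S}_0=\{(1,1)\}$, $\mathcal{S}_+=\{(\vartheta,\psi)\mid\psi>1,\ 1<\vartheta\le2-\frac1\psi\}$, $\mathcal{S}_-=\{(\vartheta,\psi)\mid0\le\psi<1,\ \max\{2-\frac1\psi,\frac1{1+\kappa(1-\psi)}\}\le\vartheta<1\}$ (for $\psi=0$ the maximum is read as $\frac1{1+\kappa}$), $$\mathcal{S}_1=\left\{(\vartheta,\psi)\;\middle|\;\psi\ne1,\ \left[1-\sqrt{\tfrac{(1-\vartheta)\vartheta}{\kappa(1-\psi)}}\right]\left[1-\tfrac{(1-\vartheta)(\mu\psi^2-L(1-\psi)^2)}{L(1-\psi)\vartheta}\right]\le\left[1-\tfrac{(1-\vartheta)\psi}{\kappa(1-\psi)}\right]^2\right\},$$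 $\mathcal{S}_c=(\mathcal{S}_-\cup\mathcal{S}_+)\cap\mathcal{S}_1$. For $(\vartheta,\psi)\in\mathcal{S}_0\cup\mathcal{S}_c$: $\alpha_{\vartheta,\psi}=\frac{1-\vartheta}{L(1-\psi)}$ if $(\vartheta,\psi)\in\mathcal{S}_c$, $\alpha_{\vartheta,\psi}$ is any number in $(0,\frac1L]$ if $(\vartheta,\psi)\in\mathcal{S}_0$; $\beta_{\vartheta,\psi}=\frac{1-\sqrt{\vartheta\alpha_{\vartheta,\psi}\mu}}{1-\alpha_{\vartheta,\psi}\psi\mu}\left[1-\sqrt{\frac{\alpha_{\vartheta,\psi}\mu}{\vartheta}}\right]$; $\gamma_{\vartheta,\psi}=\psi\beta_{\vartheta,\psi}$. With these $\alpha,\beta,\gamma$: $$\mathtt{v}=\frac{2L^2}{\mu}\left(2(\beta-\gamma)^2+(1-\alpha L)^2(1+2\gamma+2\gamma^2)\right)+\frac{\vartheta}{2\alpha}\left(1-\sqrt{\vartheta\alpha\mu}\right),\qquad \theta_u^g=\frac{2\sqrt{\vartheta\mu}}{\alpha\left(8\mathtt{v}\sqrt\alpha+\sqrt{\vartheta\mu}\,(\vartheta+\alpha L)\right)}.$$ Lyapunov function: $\mathcal{V}_P(z_k)=(z_k-z_* )^\top P(z_k-z_* )+f(x_k)-f(x_* )$ with $P=(\tilde p\tilde p^\top)\otimes I_d$, $\tilde p=\left[\sqrt{\frac{\vartheta}{2\alpha_{\vartheta,\psi}}},\ -\sqrt{\frac{\vartheta}{2\alpha_{\vartheta,\psi}}}+\sqrt{\frac\mu2}\right]^\top$.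 Entropic value at risk: with $r_{k,\sigma^2}(\theta)=\frac{2\sigma^2}{\theta}\log\mathbb{E}\left[e^{\frac{\theta}{2\sigma^2}(f(x_k)-f(x_* ))}\right]$ (possibly $+\infty$), $$\mathrm{EV@R}_{1-\zeta}[f(x_k)-f(x_* )]=\inf_{\theta>0}\left\{r_{k,\sigma^2}(\theta)+\frac{2\sigma^2}{\theta}\log\frac1\zeta\right\}.$$ *)

theory Defs
  imports "HOL-Probability.Probability"
begin

definition gradient :: "('a::real_inner \<Rightarrow> real) \<Rightarrow> 'a \<Rightarrow> 'a" where
  "gradient f x = (THE D. GDERIV f x :> D)"

definition smooth_with :: "real \<Rightarrow> ('a::real_inner \<Rightarrow> real) \<Rightarrow> bool" where
  "smooth_with L f \<longleftrightarrow> (\<forall>x. \<exists>D. GDERIV f x :> D) \<and> L-lipschitz_on UNIV (gradient f)"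

definition strongly_convex :: "real \<Rightarrow> ('a::real_inner \<Rightarrow> real) \<Rightarrow> bool" where
  "strongly_convex \<mu> f \<longleftrightarrow> convex_on UNIV (\<lambda>x. f x - \<mu> / 2 * (norm x)\<^sup>2)"

(* State (x_k, x_{k-1}) of the method started from (x0, xm1) with gradient oracle g;
   the noise used in step k \<rightarrow> k+1 is w (Suc k), so w 0 is never used. *)
primrec gmm_state ::
  "('a::real_vector \<Rightarrow> 'a) \<Rightarrow> real \<Rightarrow> real \<Rightarrow> real \<Rightarrow> 'a \<Rightarrow> 'a \<Rightarrow> (nat \<Rightarrow> 'a) \<Rightarrow> nat \<Rightarrow> 'a \<times> 'a" where
  "gmm_state g \<alpha> \<beta> \<gamma> x0 xm1 w 0 = (x0, xm1)"
| "gmm_state g \<alpha> \<beta> \<gamma> x0 xm1 w (Suc k) =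
     (let (x, xp) = gmm_state g \<alpha> \<beta> \<gamma> x0 xm1 w k;
          y = (1 + \<gamma>) *\<^sub>R x - \<gamma> *\<^sub>R xp
      in ((1 + \<beta>) *\<^sub>R x - \<beta> *\<^sub>R xp - \<alpha> *\<^sub>R (g y + w (Suc k)), x))"

(* density of N(0, \<sigma>^2 I) with respect to Lebesgue measure *)
definition isotropic_normal_density :: "real \<Rightarrow> 'a::euclidean_space \<Rightarrow> real" where
  "isotropic_normal_density \<sigma> x =
     exp (- (norm x)\<^sup>2 / (2 * \<sigma>\<^sup>2)) / sqrt ((2 * pi * \<sigma>\<^sup>2) ^ DIM('a))"

(* sigma-algebra on space M generated by the random variables X i, i \<in> I *)
definition generated_sigma ::
  "'w measure \<Rightarrow> (nat \<Rightarrow> 'w \<Rightarrow> 'a::topological_space) \<Rightarrow> nat set \<Rightarrow> 'w set set" where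
  "generated_sigma M X I =
     sigma_sets (space M) (\<Union>i\<in>I. {X i -` A \<inter> space M | A. A \<in> sets borel})"

definition S_zero :: "(real \<times> real) set" where
  "S_zero = {(1, 1)}"

definition S_plus :: "(real \<times> real) set" where
  "S_plus = {(vartheta, \<psi>). \<psi> > 1 \<and> 1 < vartheta \<and> vartheta \<le> 2 - 1 / \<psi>}"

(* At \<psi> = 0 the bound 2 - 1/\<psi> is minus infinity and drops out of the maximum
   (whereas HOL's 1/0 = 0 would turn it into 2). *)
definition S_minus :: "real \<Rightarrow> (real \<times> real) set" where
  "S_minus \<kappa> = {(vartheta, \<psi>). 0 \<le> \<psi> \<and> \<psi> < 1 \<and>
     (if \<psi> = 0 then 1 / (1 + \<kappa>) else max (2 - 1 / \<psi>) (1 / (1 + \<kappa> * (1 - \<psi>)))) \<le> vartheta \<and> vartheta < 1}"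

definition S_one :: "real \<Rightarrow> real \<Rightarrow> (real \<times> real) set" where
  "S_one \<mu> L = {(vartheta, \<psi>). \<psi> \<noteq> 1 \<and>
     (let \<kappa> = L / \<mu> in
       (1 - sqrt ((1 - vartheta) * vartheta / (\<kappa> * (1 - \<psi>)))) *
       (1 - (1 - vartheta) * (\<mu> * \<psi>\<^sup>2 - L * (1 - \<psi>)\<^sup>2) / (L * (1 - \<psi>) * vartheta))
       \<le> (1 - (1 - vartheta) * \<psi> / (\<kappa> * (1 - \<psi>)))\<^sup>2)}"

definition S_c :: "real \<Rightarrow> real \<Rightarrow> (real \<times> real) set" where
  "S_c \<mu> L = (S_minus (L / \<mu>) \<union> S_plus) \<inter> S_one \<mu> L"

definition gmm_alpha_ok :: "real \<Rightarrow> real \<Rightarrow> real \<Rightarrow> real \<Rightarrow> real \<Rightarrow> bool" where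
  "gmm_alpha_ok \<mu> L vartheta \<psi> \<alpha> \<longleftrightarrow>
     (vartheta, \<psi>) \<in> S_c \<mu> L \<and> \<alpha> = (1 - vartheta) / (L * (1 - \<psi>)) \<or>
     (vartheta, \<psi>) \<in> S_zero \<and> 0 < \<alpha> \<and> \<alpha> \<le> 1 / L"

definition gmm_beta :: "real \<Rightarrow> real \<Rightarrow> real \<Rightarrow> real \<Rightarrow> real" where
  "gmm_beta \<mu> vartheta \<psi> \<alpha> =
     (1 - sqrt (vartheta * \<alpha> * \<mu>)) / (1 - \<alpha> * \<psi> * \<mu>) * (1 - sqrt (\<alpha> * \<mu> / vartheta))"

definition gmm_gamma :: "real \<Rightarrow> real \<Rightarrow> real \<Rightarrow> real \<Rightarrow> real" where
  "gmm_gamma \<mu> vartheta \<psi> \<alpha> = \<psi> * gmm_beta \<mu> vartheta \<psi> \<alpha>"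

definition gmm_v :: "real \<Rightarrow> real \<Rightarrow> real \<Rightarrow> real \<Rightarrow> real \<Rightarrow> real \<Rightarrow> real" where
  "gmm_v \<mu> L vartheta \<alpha> \<beta> \<gamma> =
     2 * L\<^sup>2 / \<mu> * (2 * (\<beta> - \<gamma>)\<^sup>2 + (1 - \<alpha> * L)\<^sup>2 * (1 + 2 * \<gamma> + 2 * \<gamma>\<^sup>2))
     + vartheta / (2 * \<alpha>) * (1 - sqrt (vartheta * \<alpha> * \<mu>))"

definition gmm_theta_u :: "real \<Rightarrow> real \<Rightarrow> real \<Rightarrow> real \<Rightarrow> real \<Rightarrow> real" where
  "gmm_theta_u \<mu> L vartheta \<alpha> v =
     2 * sqrt (vartheta * \<mu>) / (\<alpha> * (8 * v * sqrt \<alpha> + sqrt (vartheta * \<mu>) * (vartheta + \<alpha> * L)))"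

definition gmm_rho :: "real \<Rightarrow> real \<Rightarrow> real \<Rightarrow> real \<Rightarrow> real \<Rightarrow> real \<Rightarrow> real" where
  "gmm_rho \<mu> L vartheta \<alpha> v \<theta> =
     (let D = 2 - \<theta> * \<alpha> * (vartheta + \<alpha> * L);
          b = 1 - sqrt (vartheta * \<alpha> * \<mu>) + 4 * \<theta> * \<alpha>\<^sup>2 * v / D
      in b / 2 + sqrt (b\<^sup>2 + 16 * \<theta> * \<alpha>\<^sup>2 * v / D) / 2)"

definition p_tilde :: "real \<Rightarrow> real \<Rightarrow> real \<Rightarrow> real ^ 2" where
  "p_tilde \<mu> vartheta \<alpha> =
     vector [sqrt (vartheta / (2 * \<alpha>)), - sqrt (vartheta / (2 * \<alpha>)) + sqrt (\<mu> / 2)]"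

(* the operator Q \<otimes> I on pairs of vectors *)
definition kron_id :: "real ^ 2 ^ 2 \<Rightarrow> 'a::real_vector \<times> 'a \<Rightarrow> 'a \<times> 'a" where
  "kron_id Q z =
     (Q $ 1 $ 1 *\<^sub>R fst z + Q $ 1 $ 2 *\<^sub>R snd z, Q $ 2 $ 1 *\<^sub>R fst z + Q $ 2 $ 2 *\<^sub>R snd z)"

definition lyapunov ::
  "real \<Rightarrow> real \<Rightarrow> real \<Rightarrow> ('a::real_inner \<Rightarrow> real) \<Rightarrow> 'a \<Rightarrow> 'a \<times> 'a \<Rightarrow> real" where
  "lyapunov \<mu> vartheta \<alpha> f xs z =
     (let p = p_tilde \<mu> vartheta \<alpha>; Q = (\<chi> i j. p $ i * p $ j)
      in (z - (xs, xs)) \<bullet> kron_id Q (z - (xs, xs)) + f (fst z) - f xs)"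

definition eln :: "ennreal \<Rightarrow> ereal" where
  "eln x = (if x = 0 then - \<infinity> else if x = \<infinity> then \<infinity> else ereal (ln (enn2real x)))"

(* r_{k,\<sigma>^2}(\<theta>) for a random loss X; it is +\<infinity> when the exponential moment is infinite *)
definition entropic_risk :: "'w measure \<Rightarrow> real \<Rightarrow> ('w \<Rightarrow> real) \<Rightarrow> real \<Rightarrow> ereal" where
  "entropic_risk M \<sigma> X \<theta> =
     ereal (2 * \<sigma>\<^sup>2 / \<theta>) * eln (\<integral>\<^sup>+\<omega>. ennreal (exp (\<theta> / (2 * \<sigma>\<^sup>2) * X \<omega>)) \<partial>M)"

(* EV@R at level 1 - \<zeta> *)
definition evar :: "'w measure \<Rightarrow> real \<Rightarrow> real \<Rightarrow> ('w \<Rightarrow> real) \<Rightarrow> ereal" where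
  "evar M \<sigma> \<zeta> X =
     (INF \<theta>\<in>{0<..}. entropic_risk M \<sigma> X \<theta> + ereal (2 * \<sigma>\<^sup>2 / \<theta> * ln (1 / \<zeta>)))"

end

theory Submission
  imports Defs
begin

text \<open>
  Write \<open>s = sqrt (vartheta * \<alpha> * \<mu>)\<close>, \<open>c = \<alpha> * (vartheta + \<alpha> * L)\<close> and \<open>V\<close> for the Lyapunov
  function. Without noise one step of the method multiplies \<open>V\<close> by at most \<open>1 - s\<close>: the descent
  lemma at \<open>y\<close> and strong convexity from \<open>y\<close> to \<open>x\<close> and from \<open>y\<close> to the minimizer bound
  \<open>V(z') - (1 - s) V(z)\<close> by a quadratic form in \<open>u = x - x'\<close>, \<open>e = x - xs\<close> and the gradient \<open>g\<close> at
  \<open>y\<close>. The formulas for \<open>\<beta>\<close> and \<open>\<gamma>\<close> make the three mixed coefficients and that of \<open>|e|\<^sup>2\<close> vanish,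
  the coefficient of \<open>|g|\<^sup>2\<close> is nonpositive because \<open>\<alpha> * L * \<psi> \<le> 1\<close>, and nonpositivity of the
  coefficient of \<open>|u|\<^sup>2\<close> is the inequality defining \<open>S_one\<close> (lemma \<open>noise_free_contraction\<close>).

  Noise \<open>w\<close> adds a linear and a quadratic term,
  \<open>V(z') \<le> (1 - s) V(z) + h \<bullet> w + c/2 |w|\<^sup>2\<close>. The Cauchy-Schwarz inequality together with
  \<open>|grad f|\<^sup>2 \<le> 2 L (f - f xs)\<close> bounds \<open>h\<close> by the Lyapunov function itself,
  \<open>|h|\<^sup>2 \<le> 2 c (1 - s) V(z)\<close> (lemma \<open>noisy_lyapunov_step\<close>). Hence the Gaussian average
  of \<open>exp (t V(z'))\<close> is at most a constant times \<open>exp (t' V(z))\<close>, where \<open>t' = t (1 - s) / (1 - t \<sigma>\<^sup>2 c)\<close>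
  (lemma \<open>gaussian_average_lyapunov_step\<close>).

  For \<open>t \<le> \<theta> / (2 \<sigma>\<^sup>2)\<close> this gives \<open>t' \<le> \<rho> t\<close> with the rate \<open>\<rho> < 1\<close> of the theorem
  (lemma \<open>gmm_rate_bounds\<close>). This comparison rests on \<open>\<alpha> * L \<le> 3 * vartheta\<close>, a bound on the
  parameter region that is attained at one of its corners and comes from polynomial inequalities
  (lemma \<open>alpha_L_le_three_vartheta\<close>). Since each step replaces \<open>t\<close> by \<open>\<rho> t\<close> and its constant has
  a logarithm at most linear in \<open>t\<close>, the iteration produces a geometric series
  (lemma \<open>gmm_exponential_moment\<close>), and every \<open>\<theta>' \<in> (0, \<theta>]\<close> yields an upper bound on the entropic
  value at risk. Its minimum over all \<open>\<theta>' < 2 / c\<close> is attained inside \<open>(0, \<theta>]\<close> exactly under the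
  condition on the confidence level, which gives \<open>E1\<close>; otherwise \<open>\<theta>' = \<theta>\<close> is used and gives \<open>E2\<close>.
\<close>

section \<open>The region of admissible parameters\<close>

text \<open>
  With \<open>s = sqrt (vartheta * \<alpha> * \<mu>)\<close> and \<open>t = sqrt (\<alpha> * \<mu> / vartheta)\<close> the inequality of
  \<open>S_one\<close>, multiplied by \<open>s\<close>, says that
  \<open>(1 - s) * (s * (1 - t\<^sup>2 * \<psi>\<^sup>2) + (t - s) * (1 - \<psi>)) - s * (1 - s * t * \<psi>)\<^sup>2 \<le> 0\<close>, and
  \<open>\<alpha> * L > 3 * vartheta\<close> becomes \<open>s * (4 - 3 * \<psi>) < t\<close>. The left-hand side is concave in \<open>t\<close>, so the
  two end points \<open>t = s * (4 - 3 * \<psi>)\<close> and \<open>t = 1\<close> decide its sign. At \<open>t = 1\<close> it is decreasing in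
  \<open>s\<close>, and at the extreme value \<open>s = 1 / (4 - 3 * \<psi>)\<close> it factors into positive terms.
\<close>

lemma S_one_gap_at_one:
  fixes s \<psi> :: real
  assumes s: "0 < s" "s * (4 - 3 * \<psi>) \<le> 1" and psi: "0 \<le> \<psi>" "\<psi> < 2/3"
  shows "s * (1 - s * \<psi>)\<^sup>2 < (1 - s) * (1 - \<psi>) * (1 + s * \<psi>)"
proof -
  define q where "q = 4 - 3 * \<psi>"
  define z where "z = 1 / q"
  have q: "q > 2" using psi by (simp add: q_def)
  have sz: "s \<le> z" using s q by (simp add: z_def q_def field_simps)
  have zpsi: "z * \<psi> \<le> 1/3" using psi q by (simp add: z_def q_def field_simps)
  have spsi: "s * \<psi> \<le> z * \<psi>" using sz psi by (intro mult_right_mono)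
  have z0: "z > 0" using q by (simp add: z_def)
  have mono1: "(1 - z) * (1 + z * \<psi>) \<le> (1 - s) * (1 + s * \<psi>)"
  proof -
    have "(1 - s) * (1 + s * \<psi>) - (1 - z) * (1 + z * \<psi>) = (z - s) * (1 - \<psi> + \<psi> * (s + z))"
      by (simp add: algebra_simps)
    moreover have "0 \<le> (z - s) * (1 - \<psi> + \<psi> * (s + z))"
      using sz psi s z0 by (intro mult_nonneg_nonneg add_nonneg_nonneg) auto
    ultimately show ?thesis by linarith
  qed
  have mono2: "s * (1 - s * \<psi>)\<^sup>2 \<le> z * (1 - z * \<psi>)\<^sup>2"
  proof -
    have "(1/3)\<^sup>2 \<le> (1 - s * \<psi> - z * \<psi>)\<^sup>2"
      using spsi zpsi by (intro power_mono) linarith+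
    moreover have "(s * \<psi>) * (z * \<psi>) \<le> (1/3) * (1/3)"
      using spsi zpsi s z0 psi by (intro mult_mono) auto
    ultimately have "0 \<le> (1 - s * \<psi> - z * \<psi>)\<^sup>2 - (s * \<psi>) * (z * \<psi>)"
      by (simp add: power2_eq_square)
    then have "0 \<le> (z - s) * ((1 - s * \<psi> - z * \<psi>)\<^sup>2 - (s * \<psi>) * (z * \<psi>))"
      using sz by simp
    also have "\<dots> = z * (1 - z * \<psi>)\<^sup>2 - s * (1 - s * \<psi>)\<^sup>2"
      by (simp add: power2_eq_square algebra_simps)
    finally show ?thesis by simp
  qed
  have "q ^ 3 * ((1 - \<psi>) * ((1 - z) * (1 + z * \<psi>)) - z * (1 - z * \<psi>)\<^sup>2)
      = q * (1 - \<psi>) * ((q - q * z) * (q + (q * z) * \<psi>)) - (q * z) * (q - (q * z) * \<psi>)\<^sup>2"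
    by (simp add: power2_eq_square power3_eq_cube algebra_simps)
  also have "q * z = 1" using q by (simp add: z_def)
  also have "q * (1 - \<psi>) * ((q - 1) * (q + 1 * \<psi>)) - 1 * (q - 1 * \<psi>)\<^sup>2
      = 2 * (1 - \<psi>)\<^sup>2 * (2 - 3 * \<psi>) * (8 - 3 * \<psi>)"
    by (simp add: q_def power2_eq_square algebra_simps)
  also have "\<dots> > 0" using psi by (intro mult_pos_pos) auto
  finally have "0 < (1 - \<psi>) * ((1 - z) * (1 + z * \<psi>)) - z * (1 - z * \<psi>)\<^sup>2"
    using q by (simp add: zero_less_mult_iff)
  moreover have "(1 - \<psi>) * ((1 - z) * (1 + z * \<psi>)) \<le> (1 - \<psi>) * ((1 - s) * (1 + s * \<psi>))"
    using mono1 psi by (intro mult_left_mono) auto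
  ultimately show ?thesis using mono2 by (simp add: algebra_simps)
qed

text \<open>
  The end point \<open>t = s * (4 - 3 * \<psi>)\<close> of the same concave function, written in terms of
  \<open>y = t\<close>. The difference of the two sides is its value at \<open>y = 1\<close>, which factors, plus
  \<open>(1 - y) * B y\<close>; the quotient \<open>B\<close> is in turn at least its value at \<open>1\<close>, which factors too.
\<close>

lemma S_one_gap_at_ratio:
  fixes y \<psi> :: real
  defines "q \<equiv> 4 - 3 * \<psi>"
  assumes y: "0 \<le> y" "y \<le> 1" and psi: "0 \<le> \<psi>" "\<psi> < 2/3"
  shows "(q - y * y * \<psi>)\<^sup>2 \<le> q * (q - y) * (1 + 3 * (1 - \<psi>)\<^sup>2 - y\<^sup>2 * \<psi>\<^sup>2)"
proof -
  have q: "q > 2" using psi by (simp add: q_def)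
  define B where "B = (\<lambda>y. q * (1 + 3 * (1 - \<psi>)\<^sup>2) - (1 + y) * (2 * \<psi> * q - \<psi>\<^sup>2 * q\<^sup>2)
      - (1 + y + y\<^sup>2) * \<psi>\<^sup>2 * q + (1 + y + y\<^sup>2 + y ^ 3) * \<psi>\<^sup>2)"
  define C where "C = 2 * q - \<psi> * q\<^sup>2 + \<psi> * q - \<psi> + (1 + y) * \<psi> * (q - 2) - y\<^sup>2 * \<psi>"
  have B1: "B 1 = 2 * (2 - 3 * \<psi>) * (4 - 7 * \<psi> + 6 * \<psi>\<^sup>2 - 3 * \<psi> ^ 3)"
    unfolding B_def q_def by (simp add: power2_eq_square power3_eq_cube algebra_simps)
  have "3 * \<psi> ^ 3 \<le> 2 * \<psi>\<^sup>2"
    using psi mult_right_mono[of "3 * \<psi>" 2 "\<psi>\<^sup>2"] by (simp add: power2_eq_square power3_eq_cube)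
  moreover have "0 \<le> (1 - \<psi>) * (4 - 3 * \<psi>)" using psi by (intro mult_nonneg_nonneg) auto
  moreover have "4 - 7 * \<psi> + 6 * \<psi>\<^sup>2 - 3 * \<psi> ^ 3
      = (1 - \<psi>) * (4 - 3 * \<psi>) + \<psi>\<^sup>2 + (2 * \<psi>\<^sup>2 - 3 * \<psi> ^ 3)"
    by (simp add: power2_eq_square algebra_simps)
  ultimately have "0 \<le> 4 - 7 * \<psi> + 6 * \<psi>\<^sup>2 - 3 * \<psi> ^ 3"
    using zero_le_power2[of \<psi>] by linarith
  then have B1pos: "0 \<le> B 1" unfolding B1 using psi by (intro mult_nonneg_nonneg) auto
  have "\<psi> * q \<le> 2"
  proof -
    have "2 - \<psi> * q = 3 * (\<psi> - 2/3)\<^sup>2 + 2/3"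
      by (simp add: q_def power2_eq_square algebra_simps)
    then show ?thesis using zero_le_power2[of "\<psi> - 2/3"] by linarith
  qed
  then have "0 \<le> q * (2 - \<psi> * q)" using q by simp
  moreover have "0 \<le> \<psi> * (q - 2)" using q psi by simp
  moreover have "0 \<le> (1 + y) * \<psi> * (q - 2)" using q psi y by (intro mult_nonneg_nonneg) auto
  moreover have "y\<^sup>2 * \<psi> \<le> 1 * \<psi>" using y psi by (intro mult_right_mono) (auto simp: power_le_one)
  ultimately have C: "0 \<le> C" unfolding C_def by (simp add: power2_eq_square algebra_simps)
  have "B y = B 1 + (1 - y) * \<psi> * C"
    unfolding B_def C_def by (simp add: power2_eq_square power3_eq_cube algebra_simps)
  moreover have "0 \<le> (1 - y) * \<psi> * C" using y psi C by simp
  ultimately have By: "0 \<le> B y" using B1pos by linarith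
  have "q * (q - y) * (1 + 3 * (1 - \<psi>)\<^sup>2 - y\<^sup>2 * \<psi>\<^sup>2) - (q - y * y * \<psi>)\<^sup>2
      = 2 * (1 - \<psi>)\<^sup>2 * (2 - 3 * \<psi>) * (8 - 3 * \<psi>) + (1 - y) * B y"
    unfolding B_def q_def
    by (simp add: power2_eq_square power3_eq_cube algebra_simps)
  moreover have "0 \<le> 2 * (1 - \<psi>)\<^sup>2 * (2 - 3 * \<psi>) * (8 - 3 * \<psi>)" using psi by (intro mult_nonneg_nonneg) auto
  moreover have "0 \<le> (1 - y) * B y" using y By by simp
  ultimately show ?thesis by linarith
qed

lemma S_one_gap_pos:
  fixes s t \<psi> :: real
  assumes s: "0 < s" and psi: "0 \<le> \<psi>" "\<psi> < 2/3" and t: "s * (4 - 3 * \<psi>) < t" "t \<le> 1"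
  shows "s * (1 - s * t * \<psi>)\<^sup>2 < (1 - s) * (s * (1 - t\<^sup>2 * \<psi>\<^sup>2) + (t - s) * (1 - \<psi>))"
proof -
  define q l where "q = 4 - 3 * \<psi>" and "l = s * q"
  define H where "H = (\<lambda>t. (1 - s) * (s * (1 - t\<^sup>2 * \<psi>\<^sup>2) + (t - s) * (1 - \<psi>)) - s * (1 - s * t * \<psi>)\<^sup>2)"
  have q: "q > 2" using psi by (simp add: q_def)
  have l: "l < t" "l < 1" "l > 0" using t s q by (auto simp: l_def q_def)
  have "s * 2 < l" unfolding l_def using s q by (intro mult_strict_left_mono)
  then have sq1: "s < 1" using l by linarith
  have H1: "0 < H 1"
    using S_one_gap_at_one[of s \<psi>] s psi l by (simp add: H_def l_def q_def power2_eq_square algebra_simps)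
  have "q\<^sup>2 * H l = s * (q * (q - l) * (1 + 3 * (1 - \<psi>)\<^sup>2 - l\<^sup>2 * \<psi>\<^sup>2) - (q - l * l * \<psi>)\<^sup>2)"
    unfolding H_def l_def q_def by (simp add: power2_eq_square algebra_simps)
  also have "\<dots> \<ge> 0"
    using S_one_gap_at_ratio[of l \<psi>] s psi l by (simp add: q_def)
  finally have Hl: "0 \<le> H l" using q by (simp add: zero_le_mult_iff)
  \<comment> \<open>concavity: a chord of the quadratic \<open>H\<close> lies below its graph\<close>
  have "(1 - l) * H t = (1 - t) * H l + (t - l) * H 1
      + s * ((1 - s) * \<psi>\<^sup>2 + s\<^sup>2 * \<psi>\<^sup>2) * ((1 - l) * (1 - t) * (t - l))"
    unfolding H_def by (simp add: power2_eq_square algebra_simps)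
  also have "\<dots> > 0"
    using H1 Hl l t s sq1 by (intro add_pos_nonneg add_nonneg_pos) auto
  finally have "0 < H t" using l by (simp add: zero_less_mult_iff)
  then show ?thesis by (simp add: H_def)
qed

text \<open>
  The step size absorbs the factor \<open>(1 - vartheta) / (1 - \<psi>)\<close> of the defining inequality of
  \<open>S_one\<close>; in this form the inequality also makes sense, and is true, at the exceptional point
  \<open>vartheta = \<psi> = 1\<close>.
\<close>

lemma S_one_alpha:
  fixes \<mu> L vartheta \<psi> \<alpha> :: real
  assumes mu: "0 < \<mu>" "\<mu> < L" and "vartheta > 0" "\<psi> \<noteq> 1"
    and alpha: "\<alpha> = (1 - vartheta) / (L * (1 - \<psi>))" and S: "(vartheta, \<psi>) \<in> S_one \<mu> L"
  shows "(1 - sqrt (vartheta * \<alpha> * \<mu>)) * (1 - (\<alpha> * \<mu> * \<psi>\<^sup>2 - \<alpha> * L * (1 - \<psi>)\<^sup>2) / vartheta)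
      \<le> (1 - \<alpha> * \<psi> * \<mu>)\<^sup>2"
proof -
  have L: "L > 0" using mu by simp
  define K where "K = L * (1 - \<psi>)"
  have K: "K \<noteq> 0" and th: "1 - vartheta = \<alpha> * K"
    unfolding K_def alpha using assms(4) L by simp_all
  have k: "L / \<mu> * (1 - \<psi>) = K / \<mu>" by (simp add: K_def)
  have 1: "(1 - vartheta) * vartheta / (L / \<mu> * (1 - \<psi>)) = vartheta * \<alpha> * \<mu>"
    unfolding k th using K mu(1) by (simp add: divide_simps)
  have "\<alpha> * \<mu> * \<psi>\<^sup>2 - \<alpha> * L * (1 - \<psi>)\<^sup>2 = \<alpha> * (\<mu> * \<psi>\<^sup>2 - L * (1 - \<psi>)\<^sup>2)"
    by (simp add: right_diff_distrib mult.assoc)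
  then have 2: "(1 - vartheta) * (\<mu> * \<psi>\<^sup>2 - L * (1 - \<psi>)\<^sup>2) / (L * (1 - \<psi>) * vartheta)
      = (\<alpha> * \<mu> * \<psi>\<^sup>2 - \<alpha> * L * (1 - \<psi>)\<^sup>2) / vartheta"
    unfolding th K_def[symmetric] using K by simp
  have 3: "(1 - vartheta) * \<psi> / (L / \<mu> * (1 - \<psi>)) = \<alpha> * \<psi> * \<mu>"
    unfolding k th using K mu(1) by (simp add: divide_simps)
  show ?thesis using S unfolding S_one_def mem_Collect_eq prod.case Let_def 1 2 3 by blast
qed

text \<open>
  Everything about the three branches of the parameter region that the analysis of the method
  uses, in a form common to the branches. The lower (upper) bound \<open>2 - 1 / \<psi>\<close> on \<open>vartheta\<close> is
  \<open>\<alpha> * L * \<psi> \<le> 1\<close>, and the bound \<open>1 / (1 + \<kappa> * (1 - \<psi>))\<close> is \<open>\<alpha> * \<mu> \<le> vartheta\<close>.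
\<close>

lemma gmm_parameters:
  fixes \<mu> L vartheta \<psi> \<alpha> :: real
  assumes mu: "0 < \<mu>" "\<mu> < L" and ok: "gmm_alpha_ok \<mu> L vartheta \<psi> \<alpha>"
  shows "0 < \<alpha>" "0 < vartheta" "0 \<le> \<psi>" "vartheta + \<alpha> * L * (1 - \<psi>) = 1" "\<alpha> * L * \<psi> \<le> 1"
    "\<alpha> * \<mu> \<le> vartheta" "vartheta * \<alpha> * \<mu> < 1"
    "(1 - sqrt (vartheta * \<alpha> * \<mu>)) * (1 - (\<alpha> * \<mu> * \<psi>\<^sup>2 - \<alpha> * L * (1 - \<psi>)\<^sup>2) / vartheta)
      \<le> (1 - \<alpha> * \<psi> * \<mu>)\<^sup>2"
proof -
  have L: "L > 0" using mu by simp
  let ?S1 = "(1 - sqrt (vartheta * \<alpha> * \<mu>)) * (1 - (\<alpha> * \<mu> * \<psi>\<^sup>2 - \<alpha> * L * (1 - \<psi>)\<^sup>2) / vartheta)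
      \<le> (1 - \<alpha> * \<psi> * \<mu>)\<^sup>2"
  consider (zero) "vartheta = 1" "\<psi> = 1" "0 < \<alpha>" "\<alpha> \<le> 1 / L"
    | (plus) "\<alpha> = (1 - vartheta) / (L * (1 - \<psi>))" "(vartheta, \<psi>) \<in> S_plus" "(vartheta, \<psi>) \<in> S_one \<mu> L"
    | (minus) "\<alpha> = (1 - vartheta) / (L * (1 - \<psi>))" "(vartheta, \<psi>) \<in> S_minus (L / \<mu>)" "(vartheta, \<psi>) \<in> S_one \<mu> L"
    using ok by (auto simp: gmm_alpha_ok_def S_zero_def S_c_def)
  then have "0 < \<alpha> \<and> 0 < vartheta \<and> 0 \<le> \<psi> \<and> vartheta + \<alpha> * L * (1 - \<psi>) = 1 \<and> \<alpha> * L * \<psi> \<le> 1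
    \<and> \<alpha> * \<mu> \<le> vartheta \<and> vartheta * \<alpha> * \<mu> < 1 \<and> ?S1"
  proof cases
    case zero
    have aL: "\<alpha> * L \<le> 1" using zero L by (simp add: field_simps)
    have am: "\<alpha> * \<mu> < \<alpha> * L" using zero mu by simp
    \<comment> \<open>with \<open>vartheta = 1\<close> the claim is \<open>(1 - s) * (1 - s\<^sup>2) \<le> (1 - s\<^sup>2)\<^sup>2\<close>\<close>
    define s where "s = sqrt (\<alpha> * \<mu>)"
    have s: "\<alpha> * \<mu> = s\<^sup>2" "0 \<le> s" using zero mu by (simp_all add: s_def)
    then have "s < 1" using aL am by (metis less_trans not_less one_le_power order_less_le_trans)
    then have "0 \<le> (1 - s)\<^sup>2 * ((1 + s) * s)" using s by simp
    also have "\<dots> = (1 - s\<^sup>2)\<^sup>2 - (1 - s) * (1 - s\<^sup>2)" by (simp add: power2_eq_square algebra_simps)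
    finally have "(1 - sqrt (\<alpha> * \<mu>)) * (1 - \<alpha> * \<mu>) \<le> (1 - \<alpha> * \<mu>)\<^sup>2"
      unfolding s(1) using s(2) by simp
    moreover have "\<alpha> * \<mu> < 1" using am aL by linarith
    ultimately show ?thesis using zero aL by simp
  next
    case plus
    have th: "\<psi> > 1" "1 < vartheta" "vartheta \<le> 2 - 1 / \<psi>" using plus by (auto simp: S_plus_def)
    have a: "\<alpha> * L * (\<psi> - 1) = vartheta - 1" using plus th L by (simp add: field_simps)
    have pos: "0 < \<alpha>" using plus th L by (simp add: zero_less_divide_iff mult_less_0_iff zero_less_mult_iff)
    have "\<alpha> * L * \<psi> * (\<psi> - 1) \<le> 1 * (\<psi> - 1)"
    proof -
      have "\<alpha> * L * \<psi> * (\<psi> - 1) = \<psi> * (vartheta - 1)" unfolding a[symmetric] by simp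
      also have "\<dots> \<le> 1 * (\<psi> - 1)" using th by (simp add: field_simps)
      finally show ?thesis .
    qed
    then have aL: "\<alpha> * L * \<psi> \<le> 1" using th mult_le_cancel_right[of "\<alpha> * L * \<psi>" "\<psi> - 1" 1] by simp
    have am: "\<alpha> * \<mu> < \<alpha> * L" using pos mu by simp
    have "vartheta \<le> \<psi>"
    proof -
      have "2 - 1 / \<psi> = \<psi> - (\<psi> - 1)\<^sup>2 / \<psi>" using th by (simp add: field_simps power2_eq_square)
      also have "\<dots> \<le> \<psi>" using th by simp
      finally show ?thesis using th by simp
    qed
    have "\<alpha> * \<mu> * vartheta < \<alpha> * L * \<psi>"
      using am \<open>vartheta \<le> \<psi>\<close> by (rule mult_less_le_imp_less) (use th pos mu in auto)
    moreover have "\<alpha> * L * 1 \<le> \<alpha> * L * \<psi>" using pos L th by (intro mult_left_mono) auto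
    ultimately have "\<alpha> * \<mu> \<le> vartheta" "vartheta * \<alpha> * \<mu> < 1"
      using aL am th by (simp_all add: mult.commute mult.left_commute)
    moreover have "vartheta + \<alpha> * L * (1 - \<psi>) = 1" using a by (simp add: algebra_simps)
    moreover have ?S1 using S_one_alpha[OF mu _ _ plus(1,3)] th by simp
    ultimately show ?thesis using pos th aL by simp
  next
    case minus
    have th: "0 \<le> \<psi>" "\<psi> < 1" "vartheta < 1" "1 / (1 + L / \<mu> * (1 - \<psi>)) \<le> vartheta"
      and th2: "\<psi> \<noteq> 0 \<Longrightarrow> 2 - 1 / \<psi> \<le> vartheta"
      using minus by (auto simp: S_minus_def split: if_splits)
    have k: "1 + L / \<mu> * (1 - \<psi>) > 0" using th mu by (intro add_pos_pos mult_pos_pos) auto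
    then have thpos: "vartheta > 0" using th by (smt (verit) divide_pos_pos)
    have a: "\<alpha> * L * (1 - \<psi>) = 1 - vartheta" using minus th L by (simp add: field_simps)
    have pos: "0 < \<alpha>" using minus th L by (simp add: zero_less_divide_iff)
    have aL: "\<alpha> * L * \<psi> \<le> 1"
    proof (cases "\<psi> = 0")
      case False
      have "\<alpha> * L * \<psi> * (1 - \<psi>) = \<psi> * (1 - vartheta)" unfolding a[symmetric] by simp
      also have "\<dots> \<le> 1 * (1 - \<psi>)" using th2[OF False] False th(1) by (simp add: field_simps)
      finally show ?thesis using th mult_le_cancel_right[of "\<alpha> * L * \<psi>" "1 - \<psi>" 1] by simp
    qed simp
    have "1 \<le> vartheta * (1 + L / \<mu> * (1 - \<psi>))" using th k by (simp add: field_simps)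
    then have "\<alpha> * L * (1 - \<psi>) \<le> vartheta * (L / \<mu>) * (1 - \<psi>)" using a by (simp add: algebra_simps)
    then have "\<alpha> * L \<le> vartheta * (L / \<mu>)"
      by (rule mult_right_le_imp_le) (use th(2) in auto)
    then have "\<alpha> * \<mu> * L \<le> vartheta * L" using mu by (simp add: field_simps)
    then have am: "\<alpha> * \<mu> \<le> vartheta" using L by simp
    then have "vartheta * (\<alpha> * \<mu>) \<le> vartheta * vartheta" using thpos by (intro mult_left_mono) auto
    also have "\<dots> < 1 * 1" using th thpos by (intro mult_strict_mono) auto
    finally have "vartheta * \<alpha> * \<mu> < 1" by (simp add: mult.assoc)
    moreover have ?S1 using S_one_alpha[OF mu _ _ minus(1,3)] th thpos by simp
    ultimately show ?thesis using pos th thpos a aL am by simp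
  qed
  then show "0 < \<alpha>" "0 < vartheta" "0 \<le> \<psi>" "vartheta + \<alpha> * L * (1 - \<psi>) = 1" "\<alpha> * L * \<psi> \<le> 1"
    "\<alpha> * \<mu> \<le> vartheta" "vartheta * \<alpha> * \<mu> < 1" ?S1 by blast+
qed

text \<open>
  If \<open>\<alpha> * L > 3 * vartheta\<close>, then \<open>\<alpha> * L * \<psi> \<le> 1\<close> forces \<open>\<psi> < 2/3\<close>, and the strict polynomial
  inequality of lemma \<open>S_one_gap_pos\<close> contradicts that of \<open>S_one\<close>. Equality holds at the admissible
  parameters \<open>\<psi> = 2/3\<close>, \<open>vartheta = 1/2\<close> for \<open>L = 3 * \<mu>\<close>, so the constant is optimal.
\<close>

lemma alpha_L_le_three_vartheta:
  fixes \<mu> L vartheta \<psi> \<alpha> :: real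
  assumes mu: "0 < \<mu>" "\<mu> < L" and ok: "gmm_alpha_ok \<mu> L vartheta \<psi> \<alpha>"
  shows "\<alpha> * L \<le> 3 * vartheta"
proof (rule ccontr)
  note P = gmm_parameters[OF assms]
  assume "\<not> ?thesis"
  then have big: "\<alpha> * L > 3 * vartheta" by simp
  have aL: "\<alpha> * L > 0" using P mu by simp
  have eq: "\<alpha> * L - \<alpha> * L * \<psi> = 1 - vartheta" using P(4) by (simp add: algebra_simps)
  have psi: "\<psi> < 2/3"
  proof (rule ccontr)
    assume "\<not> ?thesis"
    then have "\<alpha> * L * (2/3) \<le> \<alpha> * L * \<psi>" using aL by (intro mult_left_mono) auto
    then show False using P(2,5) eq big by linarith
  qed
  define s t where "s = sqrt (vartheta * \<alpha> * \<mu>)" and "t = sqrt (\<alpha> * \<mu> / vartheta)"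
  have "vartheta * \<alpha> * \<mu> = vartheta\<^sup>2 * (\<alpha> * \<mu> / vartheta)" using P(2) by (simp add: power2_eq_square)
  then have st: "s = vartheta * t"
    unfolding s_def t_def using P(2) by (metis abs_of_pos real_sqrt_abs real_sqrt_mult)
  have t2: "t\<^sup>2 = \<alpha> * \<mu> / vartheta" using P mu by (simp add: t_def)
  have t: "0 < t" "t \<le> 1" using P mu by (simp_all add: t_def)
  have s: "0 < s" using st t P(2) by simp
  have "s * t = vartheta * t\<^sup>2" by (simp add: st power2_eq_square)
  then have am: "s * t = \<alpha> * \<mu>" using P(2) t2 by simp
  have "vartheta * (4 - 3 * \<psi>) < 1"
  proof -
    have "3 * vartheta * (1 - \<psi>) < \<alpha> * L * (1 - \<psi>)" using big psi by (intro mult_strict_right_mono) auto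
    then show ?thesis using P(4) by (simp add: algebra_simps)
  qed
  then have "s * (4 - 3 * \<psi>) < t" using t mult_strict_right_mono[of "vartheta * (4 - 3 * \<psi>)" 1 t]
    by (simp add: st algebra_simps)
  from S_one_gap_pos[OF s P(3) psi this t(2)]
  have less: "s * (1 - s * t * \<psi>)\<^sup>2 < (1 - s) * (s * (1 - t\<^sup>2 * \<psi>\<^sup>2) + (t - s) * (1 - \<psi>))" .
  have "s * (1 - (\<alpha> * \<mu> * \<psi>\<^sup>2 - \<alpha> * L * (1 - \<psi>)\<^sup>2) / vartheta)
      = s * (1 - t\<^sup>2 * \<psi>\<^sup>2) + t * (\<alpha> * L * (1 - \<psi>)) * (1 - \<psi>)"
    unfolding t2 st using P(2) by (simp add: divide_simps) (simp add: algebra_simps power2_eq_square)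
  also have "t * (\<alpha> * L * (1 - \<psi>)) = t - s"
  proof -
    have "\<alpha> * L * (1 - \<psi>) = 1 - vartheta" using P(4) by simp
    then show ?thesis by (simp only: st) (simp add: algebra_simps)
  qed
  finally have "s * (1 - s * t * \<psi>)\<^sup>2 < s * ((1 - s) * (1 - (\<alpha> * \<mu> * \<psi>\<^sup>2 - \<alpha> * L * (1 - \<psi>)\<^sup>2) / vartheta))"
    using less by (simp only: mult.left_commute[of s])
  then have "(1 - s * t * \<psi>)\<^sup>2 < (1 - s) * (1 - (\<alpha> * \<mu> * \<psi>\<^sup>2 - \<alpha> * L * (1 - \<psi>)\<^sup>2) / vartheta)"
    using s by simp
  moreover have "s * t * \<psi> = \<alpha> * \<psi> * \<mu>" unfolding am by simp
  ultimately show False using P(8) unfolding s_def[symmetric] by simp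
qed

section \<open>Strongly convex and smooth functions\<close>

lemma gradient_has_derivative:
  assumes "smooth_with L f"
  shows "(f has_derivative (\<lambda>h. h \<bullet> gradient f x)) (at x)"
proof -
  obtain D where D: "GDERIV f x :> D" using assms by (auto simp: smooth_with_def)
  have "gradient f x = D"
    unfolding gradient_def
  proof (rule the_equality)
    show "GDERIV f x :> D" by (rule D)
  next
    fix E assume "GDERIV f x :> E"
    then have "(\<lambda>h. h \<bullet> E) = (\<lambda>h. h \<bullet> D)"
      using D has_derivative_unique unfolding gderiv_def by blast
    then have "(E - D) \<bullet> E = (E - D) \<bullet> D" by (rule fun_cong)
    then have "(E - D) \<bullet> (E - D) = 0" by (subst inner_diff_right) simp
    then show "E = D" by simp
  qed
  then show ?thesis using D by (simp add: gderiv_def)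
qed

lemma DERIV_along_line:
  assumes "smooth_with L f"
  shows "DERIV (\<lambda>t. f (x + t *\<^sub>R d)) t :> d \<bullet> gradient f (x + t *\<^sub>R d)"
proof -
  have "((\<lambda>t. x + t *\<^sub>R d) has_derivative (\<lambda>h. h *\<^sub>R d)) (at t)"
    by (auto intro!: derivative_eq_intros)
  from has_derivative_compose[OF this gradient_has_derivative[OF assms]]
  show ?thesis
    by (simp add: has_field_derivative_def mult_commute_abs)
qed

text \<open>
  Subtracting the quadratic leaves a convex function, whose restriction to the line through
  \<open>x\<close> and \<open>y\<close> lies above its tangent at \<open>x\<close>.
\<close>

lemma strongly_convex_tangent:
  assumes sc: "strongly_convex \<mu> f" and sm: "smooth_with L f"
  shows "f x + gradient f x \<bullet> (y - x) + \<mu> / 2 * (norm (y - x))\<^sup>2 \<le> f y"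
proof -
  define d where "d = y - x"
  define \<phi> where "\<phi> = (\<lambda>t. f (x + t *\<^sub>R d) - \<mu> / 2 * (norm (x + t *\<^sub>R d))\<^sup>2)"
  have cv: "convex_on UNIV (\<lambda>x. f x - \<mu> / 2 * (norm x)\<^sup>2)" using sc by (simp add: strongly_convex_def)
  have "convex_on UNIV \<phi>"
  proof (intro convex_onI)
    fix t a b :: real assume t: "0 < t" "t < 1"
    have "x + ((1 - t) *\<^sub>R a + t *\<^sub>R b) *\<^sub>R d = (1 - t) *\<^sub>R (x + a *\<^sub>R d) + t *\<^sub>R (x + b *\<^sub>R d)"
      by (simp add: algebra_simps)
    then show "\<phi> ((1 - t) *\<^sub>R a + t *\<^sub>R b) \<le> (1 - t) * \<phi> a + t * \<phi> b"
      using convex_onD[OF cv, of t "x + a *\<^sub>R d" "x + b *\<^sub>R d"] t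
      unfolding \<phi>_def by simp
  qed simp
  moreover have "DERIV \<phi> 0 :> d \<bullet> gradient f x - \<mu> * (x \<bullet> d)"
    unfolding \<phi>_def power2_norm_eq_inner inner_add_left inner_add_right inner_scaleR_left inner_scaleR_right
    by (auto intro!: derivative_eq_intros DERIV_along_line[OF sm, THEN DERIV_cong] simp: inner_commute)
  ultimately have "(d \<bullet> gradient f x - \<mu> * (x \<bullet> d)) * (1 - 0) \<le> \<phi> 1 - \<phi> 0"
    by (intro convex_on_imp_above_tangent[where A = UNIV]) auto
  moreover have "y = x + d" by (simp add: d_def)
  ultimately show ?thesis
    unfolding \<phi>_def \<open>y = x + d\<close> power2_norm_eq_inner by (simp add: inner_commute algebra_simps)
qed

text \<open>
  The descent lemma: along the segment from \<open>x\<close> to \<open>x + d\<close> the difference of the two sides has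
  a nonpositive derivative, by the Lipschitz bound on the gradient.
\<close>

lemma smooth_descent:
  assumes sm: "smooth_with L f"
  shows "f (x + d) \<le> f x + gradient f x \<bullet> d + L / 2 * (norm d)\<^sup>2"
proof -
  define \<phi> where "\<phi> = (\<lambda>t. f (x + t *\<^sub>R d) - t * (gradient f x \<bullet> d) - L / 2 * t\<^sup>2 * (norm d)\<^sup>2)"
  have deriv: "DERIV \<phi> t :> (gradient f (x + t *\<^sub>R d) - gradient f x) \<bullet> d - L * t * (norm d)\<^sup>2" for t
  proof -
    have "DERIV (\<lambda>t. t * (gradient f x \<bullet> d)) t :> gradient f x \<bullet> d"
      and "DERIV (\<lambda>t. L / 2 * t\<^sup>2 * (norm d)\<^sup>2) t :> L * t * (norm d)\<^sup>2"
      by (auto intro!: derivative_eq_intros)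
    from DERIV_diff[OF DERIV_diff[OF DERIV_along_line[OF sm, of x d t] this(1)] this(2)]
    show ?thesis unfolding \<phi>_def by (simp only: inner_diff_left inner_commute[of d])
  qed
  have neg: "(gradient f (x + t *\<^sub>R d) - gradient f x) \<bullet> d - L * t * (norm d)\<^sup>2 \<le> 0" if "0 \<le> t" for t
  proof -
    have "dist (gradient f (x + t *\<^sub>R d)) (gradient f x) \<le> L * dist (x + t *\<^sub>R d) x"
      using sm by (auto simp: smooth_with_def intro: lipschitz_onD)
    then have "norm (gradient f (x + t *\<^sub>R d) - gradient f x) \<le> L * t * norm d"
      using that by (simp add: dist_norm)
    then have "norm (gradient f (x + t *\<^sub>R d) - gradient f x) * norm d \<le> L * t * norm d * norm d"
      by (intro mult_right_mono) auto
    moreover have "(gradient f (x + t *\<^sub>R d) - gradient f x) \<bullet> d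
        \<le> norm (gradient f (x + t *\<^sub>R d) - gradient f x) * norm d"
      by (rule norm_cauchy_schwarz)
    ultimately show ?thesis by (simp add: power2_eq_square)
  qed
  have "\<phi> 1 \<le> \<phi> 0"
  proof (rule DERIV_nonpos_imp_nonincreasing[where f = \<phi>])
    show "\<exists>y. DERIV \<phi> t :> y \<and> y \<le> 0" if "0 \<le> t" for t
      using deriv neg[OF that] by blast
  qed simp
  then show ?thesis by (simp add: \<phi>_def)
qed

text \<open>
  A gradient step of length \<open>1 / L\<close> decreases \<open>f\<close> by at least \<open>|grad f|\<^sup>2 / (2 L)\<close>, but not
  below the minimum.
\<close>

lemma norm_gradient_le:
  assumes sm: "smooth_with L f" and L: "0 < L" and min: "is_arg_min f (\<lambda>_. True) xs"
  shows "(norm (gradient f x))\<^sup>2 \<le> 2 * L * (f x - f xs)"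
proof -
  have "f xs \<le> f (x + (- (1 / L)) *\<^sub>R gradient f x)"
    using min by (simp add: is_arg_min_linorder)
  also have "\<dots> \<le> f x + gradient f x \<bullet> ((- (1 / L)) *\<^sub>R gradient f x)
      + L / 2 * (norm ((- (1 / L)) *\<^sub>R gradient f x))\<^sup>2"
    by (rule smooth_descent[OF sm])
  also have "\<dots> = f x - (norm (gradient f x))\<^sup>2 / (2 * L)"
    using L by (simp add: power_mult_distrib power2_norm_eq_inner[symmetric] power_divide)
      (simp add: field_simps power2_eq_square)
  finally show ?thesis using L by (simp add: field_simps)
qed

section \<open>One step of the Lyapunov function\<close>

text \<open>
  The matrix of the Lyapunov function has rank one, so its quadratic form is a single square.
\<close>

lemma lyapunov_eq:
  fixes f :: "'a::real_inner \<Rightarrow> real"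
  shows "lyapunov \<mu> vartheta \<alpha> f xs (x, x') =
    (norm (sqrt (vartheta / (2 * \<alpha>)) *\<^sub>R (x - xs)
      + (sqrt (\<mu> / 2) - sqrt (vartheta / (2 * \<alpha>))) *\<^sub>R (x' - xs)))\<^sup>2 + f x - f xs"
proof -
  define p r where "p = sqrt (vartheta / (2 * \<alpha>))" and "r = sqrt (\<mu> / 2)"
  have "(norm (p *\<^sub>R a + (r - p) *\<^sub>R b))\<^sup>2 = p * p * (a \<bullet> a) + 2 * (p * (r - p)) * (a \<bullet> b) + (r - p) * (r - p) * (b \<bullet> b)" for a b :: 'a
    unfolding power2_norm_eq_inner by (simp add: inner_add_left inner_add_right inner_commute)
  moreover have "(a, b) \<bullet> kron_id (\<chi> i j. p_tilde \<mu> vartheta \<alpha> $ i * p_tilde \<mu> vartheta \<alpha> $ j) (a, b)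
      = p * p * (a \<bullet> a) + 2 * (p * (r - p)) * (a \<bullet> b) + (r - p) * (r - p) * (b \<bullet> b)" for a b :: 'a
    unfolding kron_id_def p_tilde_def p_def[symmetric] r_def[symmetric]
    by (simp add: inner_add_right inner_commute[of b a] del: real_sqrt_divide)
  ultimately show ?thesis
    unfolding lyapunov_def Let_def p_def[symmetric] r_def[symmetric] by simp
qed

lemma suboptimality_le_lyapunov: "f x - f xs \<le> lyapunov \<mu> vartheta \<alpha> f xs (x, x')"
  unfolding lyapunov_eq by simp

lemma lyapunov_nonneg:
  assumes "is_arg_min f (\<lambda>_. True) xs"
  shows "0 \<le> lyapunov \<mu> vartheta \<alpha> f xs z"
  using assms suboptimality_le_lyapunov[of f "fst z" xs \<mu> vartheta \<alpha> "snd z"]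
  by (auto simp: is_arg_min_linorder intro: order_trans[rotated])

text \<open>
  The coefficients of the quadratic form in the contraction argument. With \<open>t = r / p\<close> the
  definition of \<open>\<beta>\<close> reads \<open>\<beta> * (1 - \<alpha> * \<psi> * \<mu>) = (1 - s) * (1 - t)\<close>, which cancels the mixed
  term of \<open>u\<close> and \<open>e\<close>, and makes the last inequality, multiplied by \<open>(1 - \<alpha> * \<psi> * \<mu>)\<^sup>2\<close>, the
  inequality of \<open>S_one\<close> multiplied by \<open>p\<^sup>2 * (1 - s) * (1 - t)\<^sup>2\<close>.
\<close>

lemma contraction_coefficients:
  fixes \<mu> L vartheta \<psi> \<alpha> :: real
  defines "\<beta> \<equiv> gmm_beta \<mu> vartheta \<psi> \<alpha>" and "\<gamma> \<equiv> gmm_gamma \<mu> vartheta \<psi> \<alpha>"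
    and "s \<equiv> sqrt (vartheta * \<alpha> * \<mu>)"
    and "p \<equiv> sqrt (vartheta / (2 * \<alpha>))" and "r \<equiv> sqrt (\<mu> / 2)"
  assumes mu: "0 < \<mu>" "\<mu> < L" and ok: "gmm_alpha_ok \<mu> L vartheta \<psi> \<alpha>"
  shows "p\<^sup>2 = vartheta / (2 * \<alpha>)" "r\<^sup>2 = \<mu> / 2" "2 * p * r * \<alpha> = s" "0 < p" "0 < s" "s < 1"
    and "\<alpha> * (vartheta + \<alpha> * L) \<le> 2 * \<alpha>"
    and "(\<beta> - \<gamma>) * (1 - \<alpha> * L) + \<gamma> = vartheta * \<beta>"
    and "2 * p * \<beta> * r = 2 * (1 - s) * (p - r) * r + s * \<mu> * \<gamma>"
    and "p\<^sup>2 * \<beta>\<^sup>2 + L / 2 * (\<beta> - \<gamma>)\<^sup>2 \<le> (1 - s) * (p - r)\<^sup>2 + \<mu> / 2 * \<gamma>\<^sup>2"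
proof -
  note P = gmm_parameters[OF mu ok]
  define t where "t = sqrt (\<alpha> * \<mu> / vartheta)"
  define N where "N = 1 - \<alpha> * \<psi> * \<mu>"
  show p2: "p\<^sup>2 = vartheta / (2 * \<alpha>)" and r2: "r\<^sup>2 = \<mu> / 2" and p0: "0 < p"
    using P(1,2) mu by (simp_all add: p_def r_def)
  have "r = sqrt (vartheta / (2 * \<alpha>) * (\<alpha> * \<mu> / vartheta))"
    using P(1,2) by (simp add: r_def)
  then have rt: "r = p * t" unfolding real_sqrt_mult p_def t_def .
  have "s = sqrt (vartheta / (2 * \<alpha>) * (\<mu> / 2) * (2 * \<alpha>)\<^sup>2)"
    using P(1,2) by (simp add: s_def power2_eq_square)
  also have "\<dots> = p * r * (2 * \<alpha>)" 
  proof -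
    have "sqrt ((2 * \<alpha>)\<^sup>2) = 2 * \<alpha>" using P(1) by (intro real_sqrt_unique) auto
    then show ?thesis by (simp only: real_sqrt_mult[of "_ * _"] real_sqrt_mult[of "vartheta / _"] p_def r_def)
  qed
  finally show s: "2 * p * r * \<alpha> = s" by simp
  show s01: "0 < s" "s < 1" using P mu by (simp_all add: s_def)
  have aL: "\<alpha> * L - \<alpha> * L * \<psi> = 1 - vartheta" using P(4) by (simp add: algebra_simps)
  then have "vartheta + \<alpha> * L \<le> 2" using P(5) by linarith
  then show "\<alpha> * (vartheta + \<alpha> * L) \<le> 2 * \<alpha>" using P(1) by simp
  have \<gamma>: "\<gamma> = \<psi> * \<beta>" by (simp add: \<gamma>_def \<beta>_def gmm_gamma_def)
  have "(\<beta> - \<gamma>) * (1 - \<alpha> * L) + \<gamma> = \<beta> * (1 - \<alpha> * L * (1 - \<psi>))" by (simp add: \<gamma> algebra_simps)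
  also have "1 - \<alpha> * L * (1 - \<psi>) = vartheta" using P(4) by simp
  finally show "(\<beta> - \<gamma>) * (1 - \<alpha> * L) + \<gamma> = vartheta * \<beta>" by simp
  have "\<alpha> * \<psi> * \<mu> < 1"
  proof (cases "\<psi> = 0")
    case False
    then have "\<alpha> * \<psi> * \<mu> < \<alpha> * \<psi> * L" using P mu by simp
    then show ?thesis using P(5) by (simp add: algebra_simps)
  qed simp
  then have N: "0 < N" by (simp add: N_def)
  have \<beta>N: "\<beta> * N = (1 - s) * (1 - t)" using N by (simp add: \<beta>_def gmm_beta_def s_def t_def N_def)
  have ts: "t * s = \<alpha> * \<mu>"
  proof -
    have "t * s = 2 * \<alpha> * r * (p * t)" by (simp add: s[symmetric])
    also have "\<dots> = 2 * \<alpha> * r\<^sup>2" by (simp add: rt power2_eq_square)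
    finally show ?thesis by (simp add: r2)
  qed
  \<comment> \<open>the mixed coefficient of \<open>u\<close> and \<open>e\<close>; this identity dictates the value of \<open>\<beta>\<close>\<close>
  have "2 * p * \<beta> * r - s * \<mu> * \<gamma> = 2 * r * (p * (\<beta> * (1 - (t * s) * \<psi>)))"
  proof -
    have "s * \<mu> * \<gamma> = s * (2 * r\<^sup>2) * (\<psi> * \<beta>)" by (simp add: r2 \<gamma>)
    also have "\<dots> = 2 * r * (p * (\<beta> * ((t * s) * \<psi>)))" by (simp add: rt power2_eq_square)
    finally have "s * \<mu> * \<gamma> = 2 * r * (p * (\<beta> * ((t * s) * \<psi>)))" .
    then show ?thesis by (simp only:) (simp add: algebra_simps)
  qed
  also have "\<beta> * (1 - (t * s) * \<psi>) = \<beta> * N" unfolding ts N_def by (simp add: algebra_simps)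
  also have "2 * r * (p * (\<beta> * N)) = 2 * (1 - s) * (p - r) * r" unfolding \<beta>N by (simp add: rt algebra_simps)
  finally show "2 * p * \<beta> * r = 2 * (1 - s) * (p - r) * r + s * \<mu> * \<gamma>" by simp
  define X where "X = 1 - (\<alpha> * \<mu> * \<psi>\<^sup>2 - \<alpha> * L * (1 - \<psi>)\<^sup>2) / vartheta"
  have X: "(1 - s) * X \<le> N\<^sup>2" using P(8) by (simp add: X_def N_def s_def)
  have "p\<^sup>2 * X = p\<^sup>2 - (\<mu> / 2 * \<psi>\<^sup>2 - L / 2 * (1 - \<psi>)\<^sup>2)"
    unfolding X_def p2 using P(1,2) by (simp add: divide_simps) (simp add: algebra_simps)
  then have "N\<^sup>2 * (p\<^sup>2 * \<beta>\<^sup>2 + L / 2 * (\<beta> - \<gamma>)\<^sup>2 - \<mu> / 2 * \<gamma>\<^sup>2) = (\<beta> * N)\<^sup>2 * (p\<^sup>2 * X)"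
    by (simp only:) (simp add: \<gamma> power2_eq_square algebra_simps add_divide_distrib diff_divide_distrib)
  also have "\<dots> = (1 - s) * (p - r)\<^sup>2 * ((1 - s) * X)"
    unfolding \<beta>N by (simp add: rt power2_eq_square algebra_simps)
  also have "\<dots> \<le> (1 - s) * (p - r)\<^sup>2 * N\<^sup>2"
    using X s01 by (intro mult_left_mono) auto
  finally have "N\<^sup>2 * (p\<^sup>2 * \<beta>\<^sup>2 + L / 2 * (\<beta> - \<gamma>)\<^sup>2 - \<mu> / 2 * \<gamma>\<^sup>2) \<le> N\<^sup>2 * ((1 - s) * (p - r)\<^sup>2)"
    by (simp add: algebra_simps)
  then show "p\<^sup>2 * \<beta>\<^sup>2 + L / 2 * (\<beta> - \<gamma>)\<^sup>2 \<le> (1 - s) * (p - r)\<^sup>2 + \<mu> / 2 * \<gamma>\<^sup>2"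
    using N by simp
qed

text \<open>
  The Lyapunov function decreases by the factor \<open>1 - s\<close>. The three function values at the new
  iterate, at \<open>x\<close> and at \<open>xs\<close> are compared with \<open>f y\<close>, with weights \<open>1\<close>, \<open>1 - s\<close> and \<open>s\<close>, so that
  \<open>f y\<close> cancels and only inner products of \<open>u\<close>, \<open>g\<close> and \<open>e\<close> remain.
\<close>

lemma noise_free_contraction:
  fixes f :: "'a::real_inner \<Rightarrow> real" and x x' :: 'a
  assumes mu: "0 < \<mu>" "\<mu> < L" and ok: "gmm_alpha_ok \<mu> L vartheta \<psi> \<alpha>"
    and f: "strongly_convex \<mu> f" "smooth_with L f"
    and \<beta>: "\<beta> = gmm_beta \<mu> vartheta \<psi> \<alpha>" and \<gamma>: "\<gamma> = gmm_gamma \<mu> vartheta \<psi> \<alpha>"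
    and xn: "xn = (1 + \<beta>) *\<^sub>R x - \<beta> *\<^sub>R x' - \<alpha> *\<^sub>R gradient f ((1 + \<gamma>) *\<^sub>R x - \<gamma> *\<^sub>R x')"
  shows "lyapunov \<mu> vartheta \<alpha> f xs (xn, x)
    \<le> (1 - sqrt (vartheta * \<alpha> * \<mu>)) * lyapunov \<mu> vartheta \<alpha> f xs (x, x')"
proof -
  define s p r where "s = sqrt (vartheta * \<alpha> * \<mu>)" and "p = sqrt (vartheta / (2 * \<alpha>))" and "r = sqrt (\<mu> / 2)"
  note C = contraction_coefficients[OF mu ok, folded \<beta> \<gamma> s_def p_def r_def]
  note al = gmm_parameters(1)[OF mu ok]
  define y where "y = (1 + \<gamma>) *\<^sub>R x - \<gamma> *\<^sub>R x'"
  define g e u where "g = gradient f y" and "e = x - xs" and "u = x - x'"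
  define uu gg ee ug ue ge where "uu = u \<bullet> u" and "gg = g \<bullet> g" and "ee = e \<bullet> e"
    and "ug = u \<bullet> g" and "ue = u \<bullet> e" and "ge = g \<bullet> e"
  note G = uu_def gg_def ee_def ug_def ue_def ge_def
  have xn_y: "xn = y + ((\<beta> - \<gamma>) *\<^sub>R u - \<alpha> *\<^sub>R g)" and x_y: "x - y = - \<gamma> *\<^sub>R u"
    and xs_y: "xs - y = - (e + \<gamma> *\<^sub>R u)"
    by (simp_all add: xn y_def u_def g_def e_def algebra_simps)
  have V: "lyapunov \<mu> vartheta \<alpha> f xs (x, x') = (norm ((p - r) *\<^sub>R u + r *\<^sub>R e))\<^sup>2 + f x - f xs"
    unfolding lyapunov_eq s_def[symmetric] p_def[symmetric] r_def[symmetric]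
    by (simp add: u_def e_def algebra_simps)
  have Vn: "lyapunov \<mu> vartheta \<alpha> f xs (xn, x) = (norm (p *\<^sub>R (\<beta> *\<^sub>R u - \<alpha> *\<^sub>R g) + r *\<^sub>R e))\<^sup>2 + f xn - f xs"
    unfolding lyapunov_eq p_def[symmetric] r_def[symmetric]
    by (simp add: u_def e_def xn g_def y_def algebra_simps)
  have A: "(norm ((p - r) *\<^sub>R u + r *\<^sub>R e))\<^sup>2 = (p - r)\<^sup>2 * uu + 2 * (p - r) * r * ue + r\<^sup>2 * ee"
    unfolding power2_norm_eq_inner G
    by (simp add: inner_add_left inner_add_right inner_commute power2_eq_square algebra_simps)
  have An: "(norm (p *\<^sub>R (\<beta> *\<^sub>R u - \<alpha> *\<^sub>R g) + r *\<^sub>R e))\<^sup>2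
      = p\<^sup>2 * \<beta>\<^sup>2 * uu + p\<^sup>2 * \<alpha>\<^sup>2 * gg + r\<^sup>2 * ee - 2 * p\<^sup>2 * \<alpha> * \<beta> * ug + 2 * p * \<beta> * r * ue - 2 * p * r * \<alpha> * ge"
    unfolding power2_norm_eq_inner G
    by (simp add: inner_add_left inner_add_right inner_diff_left inner_diff_right inner_commute power2_eq_square algebra_simps)
  have "f xn \<le> f y + g \<bullet> ((\<beta> - \<gamma>) *\<^sub>R u - \<alpha> *\<^sub>R g) + L / 2 * (norm ((\<beta> - \<gamma>) *\<^sub>R u - \<alpha> *\<^sub>R g))\<^sup>2"
    unfolding xn_y g_def by (rule smooth_descent[OF f(2)])
  then have f1: "f xn \<le> f y + ((\<beta> - \<gamma>) * ug - \<alpha> * gg)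
      + L / 2 * ((\<beta> - \<gamma>)\<^sup>2 * uu - 2 * (\<beta> - \<gamma>) * \<alpha> * ug + \<alpha>\<^sup>2 * gg)"
    unfolding power2_norm_eq_inner G
    by (simp add: inner_diff_left inner_diff_right inner_commute power2_eq_square algebra_simps)
  have "f y + g \<bullet> (x - y) + \<mu> / 2 * (norm (x - y))\<^sup>2 \<le> f x"
    unfolding g_def by (rule strongly_convex_tangent[OF f])
  then have f2: "f y - \<gamma> * ug + \<mu> / 2 * \<gamma>\<^sup>2 * uu \<le> f x"
    unfolding x_y power2_norm_eq_inner G
    by (simp add: inner_commute power2_eq_square algebra_simps)
  have "f y + g \<bullet> (xs - y) + \<mu> / 2 * (norm (xs - y))\<^sup>2 \<le> f xs"
    unfolding g_def by (rule strongly_convex_tangent[OF f])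
  then have f3: "f y - (ge + \<gamma> * ug) + \<mu> / 2 * (ee + 2 * \<gamma> * ue + \<gamma>\<^sup>2 * uu) \<le> f xs"
    unfolding xs_y power2_norm_eq_inner G norm_minus_cancel
    by (simp add: inner_add_left inner_add_right inner_commute power2_eq_square algebra_simps)
  have "lyapunov \<mu> vartheta \<alpha> f xs (xn, x) - (1 - s) * lyapunov \<mu> vartheta \<alpha> f xs (x, x')
      = p\<^sup>2 * \<beta>\<^sup>2 * uu + p\<^sup>2 * \<alpha>\<^sup>2 * gg + r\<^sup>2 * ee - 2 * p\<^sup>2 * \<alpha> * \<beta> * ug + 2 * p * \<beta> * r * ue - 2 * p * r * \<alpha> * ge
        - (1 - s) * ((p - r)\<^sup>2 * uu + 2 * (p - r) * r * ue + r\<^sup>2 * ee)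
        + (f xn - (1 - s) * f x - s * f xs)"
    unfolding V Vn A An by (simp add: algebra_simps)
  also have "\<dots> \<le> p\<^sup>2 * \<beta>\<^sup>2 * uu + p\<^sup>2 * \<alpha>\<^sup>2 * gg + r\<^sup>2 * ee - 2 * p\<^sup>2 * \<alpha> * \<beta> * ug + 2 * p * \<beta> * r * ue - 2 * p * r * \<alpha> * ge
        - (1 - s) * ((p - r)\<^sup>2 * uu + 2 * (p - r) * r * ue + r\<^sup>2 * ee)
        + (f y + ((\<beta> - \<gamma>) * ug - \<alpha> * gg)
             + L / 2 * ((\<beta> - \<gamma>)\<^sup>2 * uu - 2 * (\<beta> - \<gamma>) * \<alpha> * ug + \<alpha>\<^sup>2 * gg)
           - (1 - s) * (f y - \<gamma> * ug + \<mu> / 2 * \<gamma>\<^sup>2 * uu)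
           - s * (f y - (ge + \<gamma> * ug) + \<mu> / 2 * (ee + 2 * \<gamma> * ue + \<gamma>\<^sup>2 * uu)))"
    using f1 f2 f3 C(5,6) by (intro add_left_mono diff_mono mult_left_mono) auto
  also have "\<dots> = (p\<^sup>2 * \<beta>\<^sup>2 + L / 2 * (\<beta> - \<gamma>)\<^sup>2 - ((1 - s) * (p - r)\<^sup>2 + \<mu> / 2 * \<gamma>\<^sup>2)) * uu
      + (p\<^sup>2 * \<alpha>\<^sup>2 - \<alpha> + L / 2 * \<alpha>\<^sup>2) * gg
      + s * (r\<^sup>2 - \<mu> / 2) * ee
      + ((\<beta> - \<gamma>) * (1 - \<alpha> * L) + \<gamma> - 2 * p\<^sup>2 * \<alpha> * \<beta>) * ug
      + (2 * p * \<beta> * r - (2 * (1 - s) * (p - r) * r + s * \<mu> * \<gamma>)) * ue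
      + (s - 2 * p * r * \<alpha>) * ge"
    by (simp add: algebra_simps power2_eq_square add_divide_distrib diff_divide_distrib)
  also have "r\<^sup>2 - \<mu> / 2 = 0" using C(2) by simp
  also have "(\<beta> - \<gamma>) * (1 - \<alpha> * L) + \<gamma> - 2 * p\<^sup>2 * \<alpha> * \<beta> = 0"
    unfolding C(8) C(1) using al by simp
  also have "2 * p * \<beta> * r - (2 * (1 - s) * (p - r) * r + s * \<mu> * \<gamma>) = 0" using C(9) by simp
  also have "s - 2 * p * r * \<alpha> = 0" using C(3) by simp
  also have "p\<^sup>2 * \<alpha>\<^sup>2 - \<alpha> + L / 2 * \<alpha>\<^sup>2 = (\<alpha> * (vartheta + \<alpha> * L) - 2 * \<alpha>) / 2"
    unfolding C(1) using al by (simp add: power2_eq_square field_simps)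
  also have "(p\<^sup>2 * \<beta>\<^sup>2 + L / 2 * (\<beta> - \<gamma>)\<^sup>2 - ((1 - s) * (p - r)\<^sup>2 + \<mu> / 2 * \<gamma>\<^sup>2)) * uu
      + (\<alpha> * (vartheta + \<alpha> * L) - 2 * \<alpha>) / 2 * gg + s * 0 * ee + 0 * ug + 0 * ue + 0 * ge \<le> 0"
  proof -
    have "(p\<^sup>2 * \<beta>\<^sup>2 + L / 2 * (\<beta> - \<gamma>)\<^sup>2 - ((1 - s) * (p - r)\<^sup>2 + \<mu> / 2 * \<gamma>\<^sup>2)) * uu \<le> 0"
      using C(10) by (intro mult_nonpos_nonneg) (auto simp: G)
    moreover have "(\<alpha> * (vartheta + \<alpha> * L) - 2 * \<alpha>) / 2 * gg \<le> 0"
      using C(7) by (intro mult_nonpos_nonneg) (auto simp: G)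
    ultimately show ?thesis by simp
  qed
  finally show ?thesis by (simp add: s_def)
qed

text \<open>
  The linear term \<open>h\<close> collects the gradients of both parts of the Lyapunov function at the
  noise-free iterate, so its square is controlled by the Lyapunov function there, which has just
  been contracted. It is this bound proportional to \<open>V(z)\<close> that makes exponential moments iterate.
\<close>

lemma noisy_lyapunov_step:
  fixes f :: "'a::real_inner \<Rightarrow> real" and x x' :: 'a
  assumes mu: "0 < \<mu>" "\<mu> < L" and ok: "gmm_alpha_ok \<mu> L vartheta \<psi> \<alpha>"
    and f: "strongly_convex \<mu> f" "smooth_with L f" "is_arg_min f (\<lambda>_. True) xs"
    and \<beta>: "\<beta> = gmm_beta \<mu> vartheta \<psi> \<alpha>" and \<gamma>: "\<gamma> = gmm_gamma \<mu> vartheta \<psi> \<alpha>"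
    and c: "c = \<alpha> * (vartheta + \<alpha> * L)" and s: "s = sqrt (vartheta * \<alpha> * \<mu>)"
    and xn: "xn = (1 + \<beta>) *\<^sub>R x - \<beta> *\<^sub>R x' - \<alpha> *\<^sub>R gradient f ((1 + \<gamma>) *\<^sub>R x - \<gamma> *\<^sub>R x')"
  obtains h where "(norm h)\<^sup>2 \<le> 2 * c * ((1 - s) * lyapunov \<mu> vartheta \<alpha> f xs (x, x'))"
    and "\<And>w. lyapunov \<mu> vartheta \<alpha> f xs (xn - \<alpha> *\<^sub>R w, x)
      \<le> (1 - s) * lyapunov \<mu> vartheta \<alpha> f xs (x, x') + h \<bullet> w + c / 2 * (norm w)\<^sup>2"
proof -
  define p r where "p = sqrt (vartheta / (2 * \<alpha>))" and "r = sqrt (\<mu> / 2)"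
  note P = gmm_parameters[OF mu ok]
  have L: "0 < L" using mu by simp
  have p2: "p\<^sup>2 = vartheta / (2 * \<alpha>)" and p: "0 < p" using P by (simp_all add: p_def)
  define A g where "A = p *\<^sub>R (xn - xs) + (r - p) *\<^sub>R (x - xs)" and "g = gradient f xn"
  define V Vn where "V = lyapunov \<mu> vartheta \<alpha> f xs (x, x')" and "Vn = lyapunov \<mu> vartheta \<alpha> f xs (xn, x)"
  have VnV: "Vn \<le> (1 - s) * V"
    unfolding V_def Vn_def s by (rule noise_free_contraction[OF mu ok f(1,2) \<beta> \<gamma> xn])
  have Vn: "Vn = (norm A)\<^sup>2 + f xn - f xs"
    by (simp add: Vn_def lyapunov_eq A_def p_def r_def)
  define h where "h = - \<alpha> *\<^sub>R ((2 * p) *\<^sub>R A + g)"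
  show thesis
  proof (rule that[of h, folded V_def])
    have "norm ((2 * p) *\<^sub>R A + g) \<le> 2 * p * norm A + norm g"
      using norm_triangle_ineq[of "(2 * p) *\<^sub>R A" g] p by simp
    then have "(norm ((2 * p) *\<^sub>R A + g))\<^sup>2 \<le> (2 * p * norm A + norm g)\<^sup>2"
      by (intro power_mono) auto
    also have "\<dots> \<le> (4 * p\<^sup>2 + 2 * L) * ((norm A)\<^sup>2 + (norm g)\<^sup>2 / (2 * L))"
    proof -
      \<comment> \<open>the Cauchy-Schwarz inequality for \<open>(2 p, sqrt (2 L))\<close> and \<open>(|A|, |g| / sqrt (2 L))\<close>\<close>
      have "0 \<le> (2 * L * norm A - 2 * p * norm g)\<^sup>2 / (2 * L)" using L by simp
      also have "\<dots> = (4 * p\<^sup>2 + 2 * L) * ((norm A)\<^sup>2 + (norm g)\<^sup>2 / (2 * L)) - (2 * p * norm A + norm g)\<^sup>2"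
        using L by (simp add: power2_eq_square field_simps)
      finally show ?thesis by simp
    qed
    also have "\<dots> \<le> (4 * p\<^sup>2 + 2 * L) * Vn"
    proof -
      have "(norm g)\<^sup>2 / (2 * L) \<le> f xn - f xs"
        using norm_gradient_le[OF f(2) L f(3), of xn] L by (simp add: g_def field_simps)
      then show ?thesis unfolding Vn using L by (intro mult_left_mono) auto
    qed
    finally have "\<alpha>\<^sup>2 * (norm ((2 * p) *\<^sub>R A + g))\<^sup>2 \<le> \<alpha>\<^sup>2 * ((4 * p\<^sup>2 + 2 * L) * Vn)"
      by (intro mult_left_mono) auto
    also have "\<dots> = 2 * c * Vn" unfolding p2 c using P(1) by (simp add: field_simps power2_eq_square)
    also have "\<dots> \<le> 2 * c * ((1 - s) * V)"
      using VnV P L unfolding c by (intro mult_left_mono) auto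
    finally show "(norm h)\<^sup>2 \<le> 2 * c * ((1 - s) * V)"
      unfolding h_def norm_scaleR power_mult_distrib by simp
  next
    fix w
    have "lyapunov \<mu> vartheta \<alpha> f xs (xn - \<alpha> *\<^sub>R w, x)
        = (norm (A - (p * \<alpha>) *\<^sub>R w))\<^sup>2 + f (xn + (- \<alpha> *\<^sub>R w)) - f xs"
      unfolding lyapunov_eq p_def[symmetric] r_def[symmetric] A_def by (simp add: algebra_simps)
    also have "\<dots> \<le> (norm (A - (p * \<alpha>) *\<^sub>R w))\<^sup>2 + (f xn + g \<bullet> (- \<alpha> *\<^sub>R w) + L / 2 * (norm (- \<alpha> *\<^sub>R w))\<^sup>2) - f xs"
      unfolding g_def by (intro add_left_mono diff_right_mono smooth_descent[OF f(2)])
    also have "\<dots> = Vn + h \<bullet> w + (p\<^sup>2 * \<alpha>\<^sup>2 + L / 2 * \<alpha>\<^sup>2) * (norm w)\<^sup>2"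
      unfolding Vn h_def power2_norm_eq_inner
      by (simp add: inner_add_left inner_diff_left inner_diff_right inner_commute power2_eq_square algebra_simps)
    also have "p\<^sup>2 * \<alpha>\<^sup>2 + L / 2 * \<alpha>\<^sup>2 = c / 2"
      unfolding p2 c using P(1) by (simp add: field_simps power2_eq_square)
    finally show "lyapunov \<mu> vartheta \<alpha> f xs (xn - \<alpha> *\<^sub>R w, x) \<le> (1 - s) * V + h \<bullet> w + c / 2 * (norm w)\<^sup>2"
      using VnV by linarith
  qed
qed

section \<open>The contraction rate of the exponential moments\<close>

text \<open>
  With \<open>K = 4 * \<theta> * \<alpha>\<^sup>2 * v / (2 - \<theta> * c)\<close> and \<open>b = 1 - s + K\<close>, the rate \<open>\<rho>\<close> is the positive
  root of \<open>r\<^sup>2 = b * r + K\<close>. The upper limit for \<open>\<theta>\<close> says precisely that \<open>2 * K < s\<close>, hence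
  \<open>b + K < 1\<close>, which places the root between \<open>b + K\<close> and \<open>1\<close>. The rate \<open>(1 - s) / (1 - \<theta> * c / 2)\<close>
  needed for exponential moments is at most \<open>b + K = 1 - s + 2 * K\<close> as soon as
  \<open>(1 - s) * c \<le> 8 * \<alpha>\<^sup>2 * v\<close>; the second summand of \<open>v\<close> alone ensures this when
  \<open>\<alpha> * L \<le> 3 * vartheta\<close>.
\<close>

lemma gmm_rate_bounds:
  fixes \<mu> L vartheta \<psi> \<alpha> \<beta> \<gamma> \<phi> v \<theta> :: real
  assumes mu: "0 < \<mu>" "\<mu> < L" and ok: "gmm_alpha_ok \<mu> L vartheta \<psi> \<alpha>" and phi: "0 < \<phi>" "\<phi> < 1"
    and v: "v = gmm_v \<mu> L vartheta \<alpha> \<beta> \<gamma>" and \<theta>: "\<theta> = \<phi> * gmm_theta_u \<mu> L vartheta \<alpha> v"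
    and \<rho>: "\<rho> = gmm_rho \<mu> L vartheta \<alpha> v \<theta>"
    and c: "c = \<alpha> * (vartheta + \<alpha> * L)" and s: "s = sqrt (vartheta * \<alpha> * \<mu>)"
  shows "0 < \<theta>" "\<theta> * c < 2" "(1 - s) / (1 - \<theta> * c / 2) \<le> \<rho>" "\<rho> < 1"
proof -
  note P = gmm_parameters[OF mu ok]
  have L: "0 < L" using mu by simp
  have s01: "0 < s" "s < 1" using P mu by (simp_all add: s)
  define m where "m = sqrt (vartheta * \<mu>)"
  have m: "0 < m" using P mu by (simp add: m_def)
  have sm: "s = m * sqrt \<alpha>" unfolding s m_def real_sqrt_mult[symmetric] by (simp add: mult.commute mult.left_commute)
  have "0 \<le> (1 + \<gamma>)\<^sup>2 + \<gamma>\<^sup>2" by simp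
  then have W: "0 \<le> 1 + 2 * \<gamma> + 2 * \<gamma>\<^sup>2" by (simp add: power2_eq_square algebra_simps)
  have "0 \<le> 2 * L\<^sup>2 / \<mu> * (2 * (\<beta> - \<gamma>)\<^sup>2 + (1 - \<alpha> * L)\<^sup>2 * (1 + 2 * \<gamma> + 2 * \<gamma>\<^sup>2))"
    using mu W
    by (intro mult_nonneg_nonneg add_nonneg_nonneg[of "2 * (\<beta> - \<gamma>)\<^sup>2"] divide_nonneg_nonneg) auto
  then have v_ge: "vartheta / (2 * \<alpha>) * (1 - s) \<le> v" by (simp add: v gmm_v_def s)
  have v0: "0 < v" using v_ge P s01 by (smt (verit) divide_pos_pos mult_pos_pos)
  have Q: "0 < 8 * v * sqrt \<alpha> + m * (vartheta + \<alpha> * L)"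
    using v0 P m L by (intro add_pos_pos mult_pos_pos) auto
  have theta: "\<theta> * (\<alpha> * (8 * v * sqrt \<alpha> + m * (vartheta + \<alpha> * L))) = 2 * \<phi> * m"
    using Q P(1) by (simp add: \<theta> gmm_theta_u_def m_def)
  show th0: "0 < \<theta>" using Q P(1) m phi unfolding \<theta> gmm_theta_u_def m_def by simp
  have "8 * \<theta> * \<alpha>\<^sup>2 * v + s * (\<theta> * c)
      = \<theta> * (\<alpha> * (8 * v * sqrt \<alpha> + m * (vartheta + \<alpha> * L))) * sqrt \<alpha>"
  proof -
    have "\<alpha>\<^sup>2 = \<alpha> * (sqrt \<alpha> * sqrt \<alpha>)" using P(1) by (simp add: power2_eq_square)
    then show ?thesis by (simp only: sm c) (simp add: algebra_simps)
  qed
  also have "\<dots> = 2 * \<phi> * s" unfolding theta by (simp add: sm)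
  also have "\<dots> < 2 * s" using phi s01 by simp
  finally have key: "8 * \<theta> * \<alpha>\<^sup>2 * v < s * (2 - \<theta> * c)" by (simp add: algebra_simps)
  have "0 < 8 * \<theta> * \<alpha>\<^sup>2 * v" using th0 P(1) v0 by simp
  then have "0 < s * (2 - \<theta> * c)" using key by linarith
  then have D: "0 < 2 - \<theta> * c" using s01 by (simp add: zero_less_mult_iff)
  then show "\<theta> * c < 2" by simp
  define K b where "K = 4 * \<theta> * \<alpha>\<^sup>2 * v / (2 - \<theta> * c)" and "b = 1 - s + K"
  have K: "0 < K" "2 * K < s" using th0 P(1) v0 D key by (simp_all add: K_def field_simps)
  have \<rho>_eq: "\<rho> = b / 2 + sqrt (b\<^sup>2 + 4 * K) / 2"
    by (simp add: \<rho> gmm_rho_def Let_def b_def K_def c s mult.assoc)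
  have bK: "b + K < 1" "0 < b" using K s01 by (simp_all add: b_def)
  have "(b + 2 * K)\<^sup>2 = b\<^sup>2 + 4 * K * (b + K)" by (simp add: power2_eq_square algebra_simps)
  also have "\<dots> \<le> b\<^sup>2 + 4 * K" using bK K by simp
  finally have "b + 2 * K \<le> sqrt (b\<^sup>2 + 4 * K)" by (rule real_le_rsqrt)
  then have ge: "1 - s + 2 * K \<le> \<rho>" using \<rho>_eq b_def by linarith
  have "b\<^sup>2 + 4 * K < (2 - b)\<^sup>2" using bK by (simp add: power2_eq_square algebra_simps)
  then have "sqrt (b\<^sup>2 + 4 * K) < 2 - b" using bK K by (intro real_less_lsqrt) auto
  then show "\<rho> < 1" by (simp add: \<rho>_eq)
  have "(1 - s) * c \<le> 4 * \<alpha> * vartheta * (1 - s)"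
  proof -
    have "c \<le> \<alpha> * (vartheta + 3 * vartheta)"
      unfolding c using P(1) alpha_L_le_three_vartheta[OF mu ok] by (intro mult_left_mono add_left_mono) auto
    then have "(1 - s) * c \<le> (1 - s) * (\<alpha> * (vartheta + 3 * vartheta))" using s01 by (intro mult_left_mono) auto
    then show ?thesis by (simp add: algebra_simps)
  qed
  also have "\<dots> = 8 * \<alpha>\<^sup>2 * (vartheta / (2 * \<alpha>) * (1 - s))"
    using P(1) by (simp add: power2_eq_square)
  also have "\<dots> \<le> 8 * \<alpha>\<^sup>2 * v" using v_ge by (intro mult_left_mono) auto
  finally have "(1 - s) * c * \<theta> \<le> 8 * \<alpha>\<^sup>2 * v * \<theta>" using th0 by (intro mult_right_mono) auto
  then have "(1 - s) * c * \<theta> / (2 - \<theta> * c) \<le> 8 * \<alpha>\<^sup>2 * v * \<theta> / (2 - \<theta> * c)"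
    using D by (intro divide_right_mono) auto
  moreover have "(1 - s) / (1 - \<theta> * c / 2) = 1 - s + (1 - s) * c * \<theta> / (2 - \<theta> * c)"
    using D by (simp add: divide_simps) (simp add: algebra_simps)
  moreover have "8 * \<alpha>\<^sup>2 * v * \<theta> / (2 - \<theta> * c) = 2 * K" by (simp add: K_def)
  ultimately show "(1 - s) / (1 - \<theta> * c / 2) \<le> \<rho>" using ge by linarith
qed

section \<open>Gaussian integrals and independence\<close>

text \<open>
  Completing the square shows that the integrand is, up to a constant, the density of another
  isotropic normal distribution. An affine substitution maps it back to the original density, so
  the normalisation of that one density is all that has to be known.
\<close>

lemma nn_integral_exp_quadratic_isotropic_normal:
  fixes h :: "'a::euclidean_space"
  assumes \<sigma>: "0 < \<sigma>" and b: "2 * b * \<sigma>\<^sup>2 < 1"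
    and one: "(\<integral>\<^sup>+u. ennreal (isotropic_normal_density \<sigma> (u::'a)) \<partial>lborel) = 1"
  shows "(\<integral>\<^sup>+u. ennreal (isotropic_normal_density \<sigma> u) * ennreal (exp (h \<bullet> u + b * (norm u)\<^sup>2)) \<partial>lborel)
    = ennreal (exp (\<sigma>\<^sup>2 * (norm h)\<^sup>2 / (2 * (1 - 2 * b * \<sigma>\<^sup>2))
        - real DIM('a) / 2 * ln (1 - 2 * b * \<sigma>\<^sup>2)))"
proof -
  define a k where "a = 1 - 2 * b * \<sigma>\<^sup>2" and "k = 1 / sqrt a"
  define m where "m = (k\<^sup>2 * \<sigma>\<^sup>2) *\<^sub>R h"
  define E where "E = exp (\<sigma>\<^sup>2 * (norm h)\<^sup>2 / (2 * a))"
  have a: "0 < a" using b by (simp add: a_def)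
  have k: "0 < k" "k\<^sup>2 * a = 1" using a by (simp_all add: k_def power_divide)
  have meas[measurable]: "isotropic_normal_density \<sigma> \<in> borel_measurable borel"
    unfolding isotropic_normal_density_def[abs_def] by measurable
  have shift: "ennreal (isotropic_normal_density \<sigma> (m + k *\<^sub>R u)) * ennreal (exp (h \<bullet> (m + k *\<^sub>R u) + b * (norm (m + k *\<^sub>R u))\<^sup>2))
      = ennreal E * ennreal (isotropic_normal_density \<sigma> u)" for u
  proof -
    define hh hu uu where "hh = h \<bullet> h" and "hu = h \<bullet> u" and "uu = u \<bullet> u"
    have "(norm (m + k *\<^sub>R u))\<^sup>2 = k\<^sup>2 * (k\<^sup>2 * \<sigma>\<^sup>2 * \<sigma>\<^sup>2 * hh + 2 * k * \<sigma>\<^sup>2 * hu + uu)"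
      unfolding power2_norm_eq_inner m_def hh_def hu_def uu_def
      by (simp add: inner_add_left inner_add_right inner_commute power2_eq_square algebra_simps)
    then have "- (norm (m + k *\<^sub>R u))\<^sup>2 / (2 * \<sigma>\<^sup>2) + b * (norm (m + k *\<^sub>R u))\<^sup>2
        = - (k\<^sup>2 * a) * (k\<^sup>2 * \<sigma>\<^sup>2 * \<sigma>\<^sup>2 * hh + 2 * k * \<sigma>\<^sup>2 * hu + uu) / (2 * \<sigma>\<^sup>2)"
      using \<sigma> by (simp add: a_def field_simps)
    also have "\<dots> = - (k\<^sup>2 * \<sigma>\<^sup>2 * hh / 2) - k * hu - uu / (2 * \<sigma>\<^sup>2)"
      unfolding k(2) using \<sigma> by (simp add: field_simps power2_eq_square)
    finally have "- (norm (m + k *\<^sub>R u))\<^sup>2 / (2 * \<sigma>\<^sup>2) + (h \<bullet> (m + k *\<^sub>R u) + b * (norm (m + k *\<^sub>R u))\<^sup>2)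
        = k\<^sup>2 * \<sigma>\<^sup>2 * hh / 2 - uu / (2 * \<sigma>\<^sup>2)"
      by (simp add: m_def inner_add_right hh_def hu_def)
    also have "k\<^sup>2 = 1 / a" using k a by (simp add: field_simps)
    finally have "exp (- (norm (m + k *\<^sub>R u))\<^sup>2 / (2 * \<sigma>\<^sup>2)) * exp (h \<bullet> (m + k *\<^sub>R u) + b * (norm (m + k *\<^sub>R u))\<^sup>2)
        = E * exp (- (norm u)\<^sup>2 / (2 * \<sigma>\<^sup>2))"
      by (simp add: E_def exp_add[symmetric] hh_def uu_def power2_norm_eq_inner mult.commute)
    then have "isotropic_normal_density \<sigma> (m + k *\<^sub>R u) * exp (h \<bullet> (m + k *\<^sub>R u) + b * (norm (m + k *\<^sub>R u))\<^sup>2)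
        = E * isotropic_normal_density \<sigma> u"
      by (simp add: isotropic_normal_density_def)
    then show ?thesis by (simp add: ennreal_mult'[symmetric] ennreal_mult''[symmetric] E_def)
  qed
  have "(\<integral>\<^sup>+u. ennreal (isotropic_normal_density \<sigma> u) * ennreal (exp (h \<bullet> u + b * (norm u)\<^sup>2)) \<partial>lborel)
      = ennreal (k ^ DIM('a)) * (ennreal E * (\<integral>\<^sup>+u. ennreal (isotropic_normal_density \<sigma> (u::'a)) \<partial>lborel))"
    using k(1)
    by (subst lborel_affine[of k m])
       (simp_all add: nn_integral_density nn_integral_distr nn_integral_cmult shift)
  also have "\<dots> = ennreal (k ^ DIM('a) * E)"
    using k(1) by (simp add: one ennreal_mult E_def)
  also have "k ^ DIM('a) = exp (- (real DIM('a) / 2 * ln a))"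
  proof -
    have "k = exp (- (ln a / 2))" using a by (simp add: k_def exp_minus ln_sqrt[symmetric] inverse_eq_divide)
    then show ?thesis by (simp add: exp_of_nat_mult[symmetric])
  qed
  also have "\<dots> * E = exp (\<sigma>\<^sup>2 * (norm h)\<^sup>2 / (2 * a) - real DIM('a) / 2 * ln a)"
    by (simp add: E_def exp_add[symmetric])
  finally show ?thesis by (simp add: a_def)
qed

text \<open>
  Independence is phrased with families of events rather than with random variables, so that the two variables may take values in different types.
\<close>

lemma (in prob_space) distr_pair_indep_set:
  assumes [measurable]: "W \<in> measurable M N" "Z \<in> measurable M N'"
    and indep: "indep_set {W -` A \<inter> space M | A. A \<in> sets N} {Z -` B \<inter> space M | B. B \<in> sets N'}"
  shows "distr M (N \<Otimes>\<^sub>M N') (\<lambda>\<omega>. (W \<omega>, Z \<omega>)) = distr M N W \<Otimes>\<^sub>M distr M N' Z"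
proof -
  interpret W: prob_space "distr M N W" by (rule prob_space_distr) simp
  interpret Z: prob_space "distr M N' Z" by (rule prob_space_distr) simp
  show ?thesis
  proof (rule pair_measure_eqI[symmetric])
    fix A B assume "A \<in> sets (distr M N W)" "B \<in> sets (distr M N' Z)"
    then have [measurable]: "A \<in> sets N" "B \<in> sets N'" by simp_all
    have "prob ((W -` A \<inter> space M) \<inter> (Z -` B \<inter> space M)) = prob (W -` A \<inter> space M) * prob (Z -` B \<inter> space M)"
      by (rule indep_setD[OF indep]) auto
    moreover have "(\<lambda>\<omega>. (W \<omega>, Z \<omega>)) -` (A \<times> B) \<inter> space M = (W -` A \<inter> space M) \<inter> (Z -` B \<inter> space M)"
      by auto
    ultimately show "emeasure (distr M N W) A * emeasure (distr M N' Z) B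
        = emeasure (distr M (N \<Otimes>\<^sub>M N') (\<lambda>\<omega>. (W \<omega>, Z \<omega>))) (A \<times> B)"
      by (simp add: emeasure_distr emeasure_eq_measure ennreal_mult')
  qed (simp_all add: W.sigma_finite_measure_axioms Z.sigma_finite_measure_axioms cong: sets_pair_measure_cong)
qed

text \<open>
  This takes the place of conditioning on the past: \<open>Z\<close> will be the current state of the method
  and \<open>W\<close> the next noise vector.
\<close>

lemma (in prob_space) nn_integral_indep_set_le:
  assumes [measurable]: "W \<in> measurable M N" "Z \<in> measurable M N'"
    and indep: "indep_set {W -` A \<inter> space M | A. A \<in> sets N} {Z -` B \<inter> space M | B. B \<in> sets N'}"
    and G[measurable]: "G \<in> borel_measurable (N \<Otimes>\<^sub>M N')"
    and le: "\<And>z. z \<in> space N' \<Longrightarrow> (\<integral>\<^sup>+w. G (w, z) \<partial>distr M N W) \<le> H z"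
  shows "(\<integral>\<^sup>+\<omega>. G (W \<omega>, Z \<omega>) \<partial>M) \<le> (\<integral>\<^sup>+\<omega>. H (Z \<omega>) \<partial>M)"
proof -
  interpret W: prob_space "distr M N W" by (rule prob_space_distr) simp
  interpret Z: prob_space "distr M N' Z" by (rule prob_space_distr) simp
  interpret pair_sigma_finite "distr M N W" "distr M N' Z" ..
  have "(\<integral>\<^sup>+\<omega>. G (W \<omega>, Z \<omega>) \<partial>M) = (\<integral>\<^sup>+p. G p \<partial>distr M (N \<Otimes>\<^sub>M N') (\<lambda>\<omega>. (W \<omega>, Z \<omega>)))"
    by (subst nn_integral_distr) auto
  also have "distr M (N \<Otimes>\<^sub>M N') (\<lambda>\<omega>. (W \<omega>, Z \<omega>)) = distr M N W \<Otimes>\<^sub>M distr M N' Z"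
    by (rule distr_pair_indep_set) (fact assms)+
  also have "(\<integral>\<^sup>+p. G p \<partial>(distr M N W \<Otimes>\<^sub>M distr M N' Z)) = (\<integral>\<^sup>+z. \<integral>\<^sup>+w. G (w, z) \<partial>distr M N W \<partial>distr M N' Z)"
    by (subst nn_integral_snd[symmetric]) auto
  also have "\<dots> = (\<integral>\<^sup>+\<omega>. \<integral>\<^sup>+w. G (w, Z \<omega>) \<partial>distr M N W \<partial>M)"
    by (subst nn_integral_distr) auto
  also have "\<dots> \<le> (\<integral>\<^sup>+\<omega>. H (Z \<omega>) \<partial>M)"
    by (intro nn_integral_mono le) (auto intro: measurable_space[of Z M N'])
  finally show ?thesis .
qed

text \<open>
  The noise is independent of the sigma-algebra of the past iterates. The current state of the
  method is measurable with respect to it, hence independent of the noise as well.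
\<close>

lemma (in prob_space) indep_set_generated_sigma:
  fixes w :: "nat \<Rightarrow> 'a \<Rightarrow> 'b::topological_space" and x :: "nat \<Rightarrow> 'a \<Rightarrow> 'c::topological_space"
  assumes indep: "indep_set (generated_sigma M w {i}) (generated_sigma M x J)"
    and Z: "Z \<in> measurable (sigma (space M) (\<Union>j\<in>J. {x j -` A \<inter> space M | A. A \<in> sets borel})) N"
  shows "random_variable N Z"
    and "indep_set {w i -` A \<inter> space M | A. A \<in> sets borel} {Z -` B \<inter> space M | B. B \<in> sets N}"
proof -
  define F where "F = sigma (space M) (\<Union>j\<in>J. {x j -` A \<inter> space M | A. A \<in> sets borel})"
  have F: "sets F = generated_sigma M x J" "space F = space M"
    unfolding F_def generated_sigma_def by (subst sets_measure_of; auto) (simp add: space_measure_of_conv)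
  have Z': "Z \<in> measurable F N" using Z by (simp add: F_def)
  have Zsub: "{Z -` A \<inter> space M | A. A \<in> sets N} \<subseteq> generated_sigma M x J"
    using measurable_sets[OF Z'] unfolding F by auto
  have wsub: "{w i -` A \<inter> space M | A. A \<in> sets borel} \<subseteq> generated_sigma M w {i}"
    unfolding generated_sigma_def by auto
  have "generated_sigma M x J \<subseteq> events"
    using indep unfolding indep_set_def indep_sets_def by (auto split: bool.splits)
  then show "random_variable N Z"
    using Zsub measurable_space[OF Z'] F by (intro measurableI) auto
  show "indep_set {w i -` A \<inter> space M | A. A \<in> sets borel} {Z -` B \<inter> space M | B. B \<in> sets N}"
    using indep unfolding indep_set_def
    by (rule indep_sets_mono_sets) (use Zsub wsub in \<open>auto split: bool.splits\<close>)
qed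

section \<open>Exponential moments along the iteration\<close>

lemma continuous_on_gradient: "smooth_with L f \<Longrightarrow> continuous_on UNIV (gradient f)"
  by (auto simp: smooth_with_def intro: lipschitz_on_continuous_on)

lemma continuous_on_smooth: "smooth_with L f \<Longrightarrow> continuous_on UNIV f"
  by (auto intro!: continuous_at_imp_continuous_on has_derivative_continuous gradient_has_derivative)

lemma continuous_on_lyapunov:
  assumes "smooth_with L f"
  shows "continuous_on UNIV (lyapunov \<mu> vartheta \<alpha> f xs)"
proof -
  have "lyapunov \<mu> vartheta \<alpha> f xs = (\<lambda>z. (norm (sqrt (vartheta / (2 * \<alpha>)) *\<^sub>R (fst z - xs)
      + (sqrt (\<mu> / 2) - sqrt (vartheta / (2 * \<alpha>))) *\<^sub>R (snd z - xs)))\<^sup>2 + f (fst z) - f xs)"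
    by (rule ext) (metis lyapunov_eq prod.collapse)
  then show ?thesis
    by (simp only:) (intro continuous_intros continuous_on_compose2[OF continuous_on_smooth[OF assms]]; simp)
qed

text \<open>
  The noise-free next iterate, as a function of the state.
\<close>

definition gmm_update ::
  "('a::real_vector \<Rightarrow> 'a) \<Rightarrow> real \<Rightarrow> real \<Rightarrow> real \<Rightarrow> 'a \<times> 'a \<Rightarrow> 'a" where
  "gmm_update g \<alpha> \<beta> \<gamma> z = (1 + \<beta>) *\<^sub>R fst z - \<beta> *\<^sub>R snd z - \<alpha> *\<^sub>R g ((1 + \<gamma>) *\<^sub>R fst z - \<gamma> *\<^sub>R snd z)"

lemma gmm_state_Suc:
  "gmm_state g \<alpha> \<beta> \<gamma> x0 xm1 w (Suc k) =
    (let z = gmm_state g \<alpha> \<beta> \<gamma> x0 xm1 w k in (gmm_update g \<alpha> \<beta> \<gamma> z - \<alpha> *\<^sub>R w (Suc k), fst z))"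
  by (simp add: gmm_update_def Let_def case_prod_beta scaleR_add_right diff_diff_eq)

text \<open>
  The Gaussian integral of the bound in \<open>noisy_lyapunov_step\<close>. With \<open>y = t * \<sigma>\<^sup>2 * c\<close> the term
  \<open>h\<close> contributes the factor \<open>1 + y / (1 - y) = 1 / (1 - y)\<close> to \<open>(1 - s) * V(z)\<close>, and the
  normalising constant is estimated by \<open>- ln (1 - y) \<le> y / (1 - y)\<close> to become linear in \<open>t\<close>.
\<close>

lemma gaussian_average_lyapunov_step:
  fixes f :: "'a::euclidean_space \<Rightarrow> real" and z :: "'a \<times> 'a"
  assumes mu: "0 < \<mu>" "\<mu> < L" and ok: "gmm_alpha_ok \<mu> L vartheta \<psi> \<alpha>"
    and f: "strongly_convex \<mu> f" "smooth_with L f" "is_arg_min f (\<lambda>_. True) xs"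
    and \<beta>: "\<beta> = gmm_beta \<mu> vartheta \<psi> \<alpha>" and \<gamma>: "\<gamma> = gmm_gamma \<mu> vartheta \<psi> \<alpha>"
    and c: "c = \<alpha> * (vartheta + \<alpha> * L)" and s: "s = sqrt (vartheta * \<alpha> * \<mu>)"
    and \<sigma>: "0 < \<sigma>" and one: "(\<integral>\<^sup>+u. ennreal (isotropic_normal_density \<sigma> (u::'a)) \<partial>lborel) = 1"
    and t: "0 \<le> t" "t \<le> T" and T: "T * \<sigma>\<^sup>2 * c < 1" and \<rho>: "(1 - s) / (1 - T * \<sigma>\<^sup>2 * c) \<le> \<rho>"
  shows "(\<integral>\<^sup>+u. ennreal (isotropic_normal_density \<sigma> u) *
      ennreal (exp (t * lyapunov \<mu> vartheta \<alpha> f xs (gmm_update (gradient f) \<alpha> \<beta> \<gamma> z - \<alpha> *\<^sub>R u, fst z))) \<partial>lborel)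
    \<le> ennreal (exp (t * (real DIM('a) / 2 * (\<sigma>\<^sup>2 * c / (1 - T * \<sigma>\<^sup>2 * c)) + \<rho> * lyapunov \<mu> vartheta \<alpha> f xs z)))"
proof -
  define V where "V = lyapunov \<mu> vartheta \<alpha> f xs z"
  note P = gmm_parameters[OF mu ok]
  have s1: "s < 1" using P mu by (simp add: s)
  have c0: "0 < c" unfolding c using P mu by (intro mult_pos_pos add_pos_pos) auto
  have V0: "0 \<le> V" unfolding V_def by (rule lyapunov_nonneg[OF f(3)])
  obtain h where h: "(norm h)\<^sup>2 \<le> 2 * c * ((1 - s) * V)"
    and step: "\<And>u. lyapunov \<mu> vartheta \<alpha> f xs (gmm_update (gradient f) \<alpha> \<beta> \<gamma> z - \<alpha> *\<^sub>R u, fst z)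
      \<le> (1 - s) * V + h \<bullet> u + c / 2 * (norm u)\<^sup>2"
    using noisy_lyapunov_step[OF mu ok f \<beta> \<gamma> c s, of "gmm_update (gradient f) \<alpha> \<beta> \<gamma> z" "fst z" "snd z"]
    unfolding V_def prod.collapse by (metis gmm_update_def)
  define y where "y = t * \<sigma>\<^sup>2 * c"
  have yT: "y \<le> T * \<sigma>\<^sup>2 * c" unfolding y_def using t c0 by (intro mult_right_mono) auto
  have y: "0 \<le> y" "y < 1" using t c0 yT T by (auto simp: y_def)
  have b: "2 * (t * c / 2) * \<sigma>\<^sup>2 = y" by (simp add: y_def)
  have "(\<integral>\<^sup>+u. ennreal (isotropic_normal_density \<sigma> u) *
      ennreal (exp (t * lyapunov \<mu> vartheta \<alpha> f xs (gmm_update (gradient f) \<alpha> \<beta> \<gamma> z - \<alpha> *\<^sub>R u, fst z))) \<partial>lborel)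
    \<le> (\<integral>\<^sup>+u. ennreal (exp (t * ((1 - s) * V))) * (ennreal (isotropic_normal_density \<sigma> u) *
      ennreal (exp ((t *\<^sub>R h) \<bullet> u + t * c / 2 * (norm u)\<^sup>2))) \<partial>lborel)"
  proof (rule nn_integral_mono)
    fix u :: 'a
    have "t * lyapunov \<mu> vartheta \<alpha> f xs (gmm_update (gradient f) \<alpha> \<beta> \<gamma> z - \<alpha> *\<^sub>R u, fst z)
        \<le> t * ((1 - s) * V + h \<bullet> u + c / 2 * (norm u)\<^sup>2)"
      by (intro mult_left_mono step t)
    also have "\<dots> = t * ((1 - s) * V) + ((t *\<^sub>R h) \<bullet> u + t * c / 2 * (norm u)\<^sup>2)" by (simp add: algebra_simps)
    finally have "ennreal (exp (t * lyapunov \<mu> vartheta \<alpha> f xs (gmm_update (gradient f) \<alpha> \<beta> \<gamma> z - \<alpha> *\<^sub>R u, fst z)))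
        \<le> ennreal (exp (t * ((1 - s) * V))) * ennreal (exp ((t *\<^sub>R h) \<bullet> u + t * c / 2 * (norm u)\<^sup>2))"
      by (simp add: ennreal_mult'[symmetric] exp_add[symmetric])
    then show "ennreal (isotropic_normal_density \<sigma> u) *
      ennreal (exp (t * lyapunov \<mu> vartheta \<alpha> f xs (gmm_update (gradient f) \<alpha> \<beta> \<gamma> z - \<alpha> *\<^sub>R u, fst z)))
      \<le> ennreal (exp (t * ((1 - s) * V))) * (ennreal (isotropic_normal_density \<sigma> u) *
      ennreal (exp ((t *\<^sub>R h) \<bullet> u + t * c / 2 * (norm u)\<^sup>2)))"
      by (subst mult.left_commute) (intro mult_left_mono, auto)
  qed
  also have "\<dots> = ennreal (exp (t * ((1 - s) * V))) * (\<integral>\<^sup>+u. ennreal (isotropic_normal_density \<sigma> u) *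
      ennreal (exp ((t *\<^sub>R h) \<bullet> u + t * c / 2 * (norm u)\<^sup>2)) \<partial>lborel)"
    unfolding isotropic_normal_density_def by (intro nn_integral_cmult) measurable
  also have "\<dots> = ennreal (exp (t * ((1 - s) * V)) * exp (\<sigma>\<^sup>2 * (norm (t *\<^sub>R h))\<^sup>2 / (2 * (1 - y)) - real DIM('a) / 2 * ln (1 - y)))"
    using nn_integral_exp_quadratic_isotropic_normal[OF \<sigma> _ one, of "t * c / 2" "t *\<^sub>R h"] y
    unfolding b by (simp add: ennreal_mult')
  also have "\<dots> \<le> ennreal (exp (t * (real DIM('a) / 2 * (\<sigma>\<^sup>2 * c / (1 - T * \<sigma>\<^sup>2 * c)) + \<rho> * V)))"
  proof -
    have "\<sigma>\<^sup>2 * (norm (t *\<^sub>R h))\<^sup>2 / (2 * (1 - y)) = \<sigma>\<^sup>2 * t\<^sup>2 / (2 * (1 - y)) * (norm h)\<^sup>2"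
      by (simp add: power_mult_distrib)
    also have "\<dots> \<le> \<sigma>\<^sup>2 * t\<^sup>2 / (2 * (1 - y)) * (2 * c * ((1 - s) * V))"
      using h y by (intro mult_left_mono) auto
    also have "\<dots> = t * ((1 - s) * V) * (y / (1 - y))"
      using y by (simp add: divide_simps) (simp add: y_def power2_eq_square algebra_simps)
    finally have "t * ((1 - s) * V) + \<sigma>\<^sup>2 * (norm (t *\<^sub>R h))\<^sup>2 / (2 * (1 - y)) \<le> t * ((1 - s) * V) * (1 + y / (1 - y))"
      by (simp only: distrib_left mult_1_right)
    also have "\<dots> = t * V * ((1 - s) / (1 - y))" using y by (simp add: field_simps)
    also have "\<dots> \<le> t * V * \<rho>"
    proof -
      have "(1 - s) / (1 - y) \<le> (1 - s) / (1 - T * \<sigma>\<^sup>2 * c)"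
        using yT T s1 y by (intro divide_left_mono) auto
      then show ?thesis using \<rho> t V0 by (intro mult_left_mono) auto
    qed
    finally have 1: "t * ((1 - s) * V) + \<sigma>\<^sup>2 * (norm (t *\<^sub>R h))\<^sup>2 / (2 * (1 - y)) \<le> t * (\<rho> * V)"
      by (simp add: algebra_simps)
    have "- ln (1 - y) = ln (1 / (1 - y))" using y by (simp add: ln_div)
    also have "\<dots> \<le> 1 / (1 - y) - 1" using y by (intro ln_le_minus_one) auto
    also have "\<dots> = y / (1 - y)" using y by (simp add: field_simps)
    also have "\<dots> \<le> y / (1 - T * \<sigma>\<^sup>2 * c)" using yT T y by (intro divide_left_mono) auto
    finally have "real DIM('a) / 2 * (- ln (1 - y)) \<le> real DIM('a) / 2 * (y / (1 - T * \<sigma>\<^sup>2 * c))"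
      by (intro mult_left_mono) auto
    also have "\<dots> = t * (real DIM('a) / 2 * (\<sigma>\<^sup>2 * c / (1 - T * \<sigma>\<^sup>2 * c)))" by (simp add: y_def)
    finally have "t * ((1 - s) * V) + (\<sigma>\<^sup>2 * (norm (t *\<^sub>R h))\<^sup>2 / (2 * (1 - y)) - real DIM('a) / 2 * ln (1 - y))
        \<le> t * (real DIM('a) / 2 * (\<sigma>\<^sup>2 * c / (1 - T * \<sigma>\<^sup>2 * c)) + \<rho> * V)"
      unfolding distrib_left[of t] using 1 by simp
    then show ?thesis by (simp add: exp_add[symmetric])
  qed
  finally show ?thesis by (simp add: V_def)
qed

text \<open>
  Induction on \<open>k\<close> with \<open>t\<close> arbitrary: one step of the method replaces \<open>t\<close> by \<open>\<rho> * t\<close> and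
  contributes \<open>t * B\<close> to the exponent. The closed form with \<open>B / (1 - \<rho>)\<close> is the fixed point of
  \<open>B + \<rho> * _\<close>, hence is reproduced exactly.
\<close>

lemma gmm_exponential_moment:
  fixes f :: "'a::euclidean_space \<Rightarrow> real" and w x :: "nat \<Rightarrow> 'w \<Rightarrow> 'a"
  assumes mu: "0 < \<mu>" "\<mu> < L" and ok: "gmm_alpha_ok \<mu> L vartheta \<psi> \<alpha>"
    and f: "strongly_convex \<mu> f" "smooth_with L f" "is_arg_min f (\<lambda>_. True) xs"
    and \<beta>: "\<beta> = gmm_beta \<mu> vartheta \<psi> \<alpha>" and \<gamma>: "\<gamma> = gmm_gamma \<mu> vartheta \<psi> \<alpha>"
    and c: "c = \<alpha> * (vartheta + \<alpha> * L)" and s: "s = sqrt (vartheta * \<alpha> * \<mu>)"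
    and x: "x = (\<lambda>k \<omega>. fst (gmm_state (gradient f) \<alpha> \<beta> \<gamma> x0 xm1 (\<lambda>i. w i \<omega>) k))"
    and M: "prob_space M" and \<sigma>: "0 < \<sigma>"
    and w_gaussian:
      "\<And>k. distributed M lborel (w (Suc k)) (\<lambda>u. ennreal (isotropic_normal_density \<sigma> u))"
    and w_indep:
      "\<And>k. prob_space.indep_set M (generated_sigma M w {Suc k}) (generated_sigma M x {0..k})"
    and T: "T * \<sigma>\<^sup>2 * c < 1" and \<rho>: "(1 - s) / (1 - T * \<sigma>\<^sup>2 * c) \<le> \<rho>" "\<rho> < 1"
    and t: "0 \<le> t" "t \<le> T"
  shows "(\<integral>\<^sup>+\<omega>. ennreal (exp (t * lyapunov \<mu> vartheta \<alpha> f xs (gmm_state (gradient f) \<alpha> \<beta> \<gamma> x0 xm1 (\<lambda>i. w i \<omega>) k))) \<partial>M)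
    \<le> ennreal (exp (t * (real DIM('a) / 2 * (\<sigma>\<^sup>2 * c / (1 - T * \<sigma>\<^sup>2 * c)) / (1 - \<rho>)
        + \<rho> ^ k * lyapunov \<mu> vartheta \<alpha> f xs (x0, xm1))))"
proof -
  interpret prob_space M by (rule M)
  define Z where "Z = (\<lambda>k \<omega>. gmm_state (gradient f) \<alpha> \<beta> \<gamma> x0 xm1 (\<lambda>i. w i \<omega>) k)"
  define V where "V = lyapunov \<mu> vartheta \<alpha> f xs"
  define B where "B = real DIM('a) / 2 * (\<sigma>\<^sup>2 * c / (1 - T * \<sigma>\<^sup>2 * c))"
  define U where "U = gmm_update (gradient f) \<alpha> \<beta> \<gamma>"
  note P = gmm_parameters[OF mu ok]
  have c0: "0 < c" unfolding c using P mu by (intro mult_pos_pos add_pos_pos) auto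
  have B0: "0 \<le> B" using c0 T by (simp add: B_def)
  have s1: "s < 1" using P mu by (simp add: s)
  have \<rho>0: "0 \<le> \<rho>" using s1 T by (intro order_trans[OF _ \<rho>(1)]) auto
  have ZSuc: "Z (Suc k) \<omega> = (U (Z k \<omega>) - \<alpha> *\<^sub>R w (Suc k) \<omega>, fst (Z k \<omega>))" for k \<omega>
    unfolding Z_def U_def by (subst gmm_state_Suc) (simp add: Let_def)
  have fstZ: "fst (Z k \<omega>) = x k \<omega>" for k \<omega> by (simp add: Z_def x)
  have wd: "distr M borel (w (Suc k)) = density lborel (\<lambda>u. ennreal (isotropic_normal_density \<sigma> u))" for k
    using distributed_distr_eq_density[OF w_gaussian[of k]] by (simp cong: distr_cong)
  have meas[measurable]: "isotropic_normal_density \<sigma> \<in> borel_measurable (borel :: 'a measure)"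
    unfolding isotropic_normal_density_def[abs_def] by measurable
  \<comment> \<open>the density integrates to one because it is the density of the noise\<close>
  have one: "(\<integral>\<^sup>+u. ennreal (isotropic_normal_density \<sigma> (u::'a)) \<partial>lborel) = 1"
  proof -
    have "prob_space (distr M lborel (w (Suc 0)))"
      by (rule prob_space_distr) (rule distributed_measurable[OF w_gaussian])
    then have "emeasure (density lborel (\<lambda>u. ennreal (isotropic_normal_density \<sigma> (u::'a)))) UNIV = 1"
      unfolding distributed_distr_eq_density[OF w_gaussian[of 0]]
      using prob_space.emeasure_space_1 by fastforce
    then show ?thesis by (simp add: emeasure_density)
  qed
  have cV: "continuous_on UNIV V" unfolding V_def by (rule continuous_on_lyapunov[OF f(2)])
  then have V_meas[measurable]: "V \<in> borel_measurable borel" by (rule borel_measurable_continuous_onI)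
  have Z_meas: "Z k \<in> measurable (sigma (space M) (\<Union>j\<in>{0..k}. {x j -` A \<inter> space M | A. A \<in> sets borel})) borel"
    (is "_ \<in> measurable ?F _") for k
  proof -
    have xF: "x j \<in> measurable ?F borel" if "j \<le> k" for j
    proof (rule measurableI)
      fix A :: "'a set" assume "A \<in> sets borel"
      then have "x j -` A \<inter> space M \<in> (\<Union>j\<in>{0..k}. {x j -` A \<inter> space M | A. A \<in> sets borel})"
        using that \<open>A \<in> sets borel\<close> by (intro UN_I[of j]) auto
      then show "x j -` A \<inter> space ?F \<in> sets ?F"
        by (subst sets_measure_of) (auto simp: space_measure_of_conv)
    qed simp
    have "(\<lambda>\<omega>. snd (Z k \<omega>)) \<in> measurable ?F borel"
    proof (cases k)
      case 0 then show ?thesis by (simp add: Z_def)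
    next
      case (Suc j)
      then have "(\<lambda>\<omega>. snd (Z k \<omega>)) = x j" by (simp add: ZSuc fstZ)
      then show ?thesis using xF[of j] Suc by simp
    qed
    moreover have "(\<lambda>\<omega>. fst (Z k \<omega>)) \<in> measurable ?F borel"
      using xF[of k] by (simp add: fstZ)
    ultimately have "(\<lambda>\<omega>. (fst (Z k \<omega>), snd (Z k \<omega>))) \<in> measurable ?F (borel \<Otimes>\<^sub>M borel)"
      by (intro measurable_Pair)
    then show ?thesis by (simp add: borel_prod)
  qed
  note indep = indep_set_generated_sigma[OF w_indep Z_meas]
  have ZM[measurable]: "Z k \<in> measurable M borel" for k
    by (rule indep(1))
  have wM: "w (Suc k) \<in> measurable M borel" for k
    using distributed_measurable[OF w_gaussian[of k]] by simp
  have "(\<integral>\<^sup>+\<omega>. ennreal (exp (t * V (Z k \<omega>))) \<partial>M) \<le> ennreal (exp (t * (B / (1 - \<rho>) + \<rho> ^ k * V (x0, xm1))))"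
    using t
  proof (induction k arbitrary: t)
    case 0
    have "t * V (x0, xm1) \<le> t * (B / (1 - \<rho>) + \<rho> ^ 0 * V (x0, xm1))"
      using 0 B0 \<rho>(2) by (intro mult_left_mono) auto
    then show ?case by (simp add: Z_def emeasure_space_1)
  next
    case (Suc k)
    define G where "G = (\<lambda>p. ennreal (exp (t * V (U (snd p) - \<alpha> *\<^sub>R fst p, fst (snd p)))))"
    define H where "H = (\<lambda>z. ennreal (exp (t * (B + \<rho> * V z))))"
    have "continuous_on UNIV (\<lambda>p. V (U (snd p) - \<alpha> *\<^sub>R fst p, fst (snd p)))"
      unfolding U_def gmm_update_def
      by (intro continuous_intros continuous_on_compose2[OF cV]
          continuous_on_compose2[OF continuous_on_gradient[OF f(2)]]) auto
    then have "continuous_on UNIV (\<lambda>p. exp (t * V (U (snd p) - \<alpha> *\<^sub>R fst p, fst (snd p))))"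
      by (intro continuous_on_exp continuous_on_mult_left)
    then have "G \<in> borel_measurable borel"
      unfolding G_def by (rule measurable_compose[OF borel_measurable_continuous_onI measurable_ennreal])
    then have G: "G \<in> borel_measurable (borel \<Otimes>\<^sub>M borel)" by (simp add: borel_prod)
    have "(\<integral>\<^sup>+\<omega>. ennreal (exp (t * V (Z (Suc k) \<omega>))) \<partial>M) = (\<integral>\<^sup>+\<omega>. G (w (Suc k) \<omega>, Z k \<omega>) \<partial>M)"
      by (simp add: G_def ZSuc)
    also have "\<dots> \<le> (\<integral>\<^sup>+\<omega>. H (Z k \<omega>) \<partial>M)"
    proof (rule nn_integral_indep_set_le[OF wM ZM indep(2) G])
      fix z :: "'a \<times> 'a"
      have [measurable]: "(\<lambda>u. G (u, z)) \<in> borel_measurable borel"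
        by (rule measurable_compose[OF measurable_Pair2' G]) simp
      have "(\<integral>\<^sup>+u. G (u, z) \<partial>distr M borel (w (Suc k)))
          = (\<integral>\<^sup>+u. ennreal (isotropic_normal_density \<sigma> u) * G (u, z) \<partial>lborel)"
        unfolding wd by (intro nn_integral_density) simp_all
      also have "\<dots> \<le> H z"
        unfolding G_def H_def V_def U_def B_def fst_conv snd_conv
        by (rule gaussian_average_lyapunov_step[OF mu ok f \<beta> \<gamma> c s \<sigma> one Suc.prems T \<rho>(1)])
      finally show "(\<integral>\<^sup>+u. G (u, z) \<partial>distr M borel (w (Suc k))) \<le> H z" .
    qed
    also have "\<dots> = (\<integral>\<^sup>+\<omega>. ennreal (exp (t * B)) * ennreal (exp ((\<rho> * t) * V (Z k \<omega>))) \<partial>M)"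
      unfolding H_def by (simp add: ennreal_mult'[symmetric] exp_add[symmetric] algebra_simps)
    also have "\<dots> = ennreal (exp (t * B)) * (\<integral>\<^sup>+\<omega>. ennreal (exp ((\<rho> * t) * V (Z k \<omega>))) \<partial>M)"
      by (intro nn_integral_cmult) measurable
    also have "\<dots> \<le> ennreal (exp (t * B)) * ennreal (exp ((\<rho> * t) * (B / (1 - \<rho>) + \<rho> ^ k * V (x0, xm1))))"
    proof (intro mult_left_mono Suc.IH)
      show "0 \<le> \<rho> * t" using \<rho>0 Suc.prems by simp
      have "\<rho> * t \<le> 1 * t" using \<rho>(2) Suc.prems by (intro mult_right_mono) auto
      then show "\<rho> * t \<le> T" using Suc.prems by simp
    qed simp
    also have "\<dots> = ennreal (exp (t * (B + \<rho> * (B / (1 - \<rho>)) + \<rho> ^ Suc k * V (x0, xm1))))"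
      by (simp add: ennreal_mult'[symmetric] exp_add[symmetric] algebra_simps)
    also have "B + \<rho> * (B / (1 - \<rho>)) = B / (1 - \<rho>)" using \<rho>(2) by (simp add: field_simps)
    finally show ?case .
  qed
  then show ?thesis by (simp add: Z_def V_def B_def)
qed

section \<open>From exponential moments to the entropic value at risk\<close>

lemma entropic_risk_le:
  assumes \<sigma>: "0 < \<sigma>" and \<theta>: "0 < \<theta>"
    and le: "(\<integral>\<^sup>+\<omega>. ennreal (exp (\<theta> / (2 * \<sigma>\<^sup>2) * X \<omega>)) \<partial>M) \<le> ennreal (exp (\<theta> / (2 * \<sigma>\<^sup>2) * B))"
  shows "entropic_risk M \<sigma> X \<theta> \<le> ereal B"
proof -
  define I where "I = (\<integral>\<^sup>+\<omega>. ennreal (exp (\<theta> / (2 * \<sigma>\<^sup>2) * X \<omega>)) \<partial>M)"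
  have "I < \<infinity>" using le unfolding I_def by (rule le_less_trans) simp
  have k: "0 < 2 * \<sigma>\<^sup>2 / \<theta>" using \<sigma> \<theta> by simp
  show ?thesis
  proof (cases "I = 0")
    case True
    then show ?thesis unfolding entropic_risk_def I_def[symmetric] eln_def using \<sigma> \<theta> by simp
  next
    case False
    then have pos: "0 < enn2real I" using \<open>I < \<infinity>\<close> by (simp add: enn2real_positive_iff zero_less_iff_neq_zero)
    have "enn2real I \<le> enn2real (ennreal (exp (\<theta> / (2 * \<sigma>\<^sup>2) * B)))"
      using le unfolding I_def by (rule enn2real_mono) simp
    then have "enn2real I \<le> exp (\<theta> / (2 * \<sigma>\<^sup>2) * B)" by simp
    then have "ln (enn2real I) \<le> \<theta> / (2 * \<sigma>\<^sup>2) * B" using pos by (metis ln_exp ln_le_cancel_iff exp_gt_zero)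
    then have "2 * \<sigma>\<^sup>2 / \<theta> * ln (enn2real I) \<le> 2 * \<sigma>\<^sup>2 / \<theta> * (\<theta> / (2 * \<sigma>\<^sup>2) * B)"
      using k by (intro mult_left_mono) auto
    also have "\<dots> = B" using \<sigma> \<theta> by simp
    finally show ?thesis
      using False \<open>I < \<infinity>\<close> unfolding entropic_risk_def I_def[symmetric] eln_def by simp
  qed
qed

text \<open>
  Minimisation of \<open>A * c / (2 - \<theta>' * c) + 2 * l / \<theta>'\<close> over \<open>\<theta>'\<close>. With \<open>a = sqrt A\<close> and
  \<open>b = sqrt (2 * l)\<close> the derivative vanishes where \<open>\<theta>' * c : (2 - \<theta>' * c) = b : a\<close>, and the
  assumption on \<open>l\<close> says that this point does not exceed \<open>\<theta>\<close>.
\<close>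

lemma optimal_risk_parameter:
  fixes A l c \<theta> :: real
  assumes A: "0 < A" and l: "0 < l" and c: "0 < c" and \<theta>: "0 < \<theta>" "\<theta> * c < 2"
    and small: "l \<le> A / 2 * (\<theta> * c / (2 - \<theta> * c))\<^sup>2"
  obtains \<theta>' where "0 < \<theta>'" "\<theta>' \<le> \<theta>"
    and "A * c / (2 - \<theta>' * c) + 2 * l / \<theta>' = c / 2 * (sqrt A + sqrt (2 * l))\<^sup>2"
proof -
  define a b where "a = sqrt A" and "b = sqrt (2 * l)"
  have ab: "0 < a" "0 < b" "A = a\<^sup>2" "2 * l = b\<^sup>2" using A l by (simp_all add: a_def b_def)
  define \<theta>' where "\<theta>' = 2 * b / ((a + b) * c)"
  have "b \<le> a * (\<theta> * c / (2 - \<theta> * c))"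
  proof (rule power2_le_imp_le)
    show "b\<^sup>2 \<le> (a * (\<theta> * c / (2 - \<theta> * c)))\<^sup>2"
      using small unfolding ab(4)[symmetric] power_mult_distrib ab(3)[symmetric] by simp
    show "0 \<le> a * (\<theta> * c / (2 - \<theta> * c))" using ab \<theta> c by simp
  qed
  then have "2 * b \<le> \<theta> * ((a + b) * c)" using \<theta> by (simp add: field_simps)
  moreover have pos: "0 < (a + b) * c" using ab c by simp
  ultimately have "\<theta>' \<le> \<theta>" unfolding \<theta>'_def by (simp add: field_simps)
  moreover have "0 < \<theta>'" unfolding \<theta>'_def using ab pos by simp
  moreover have "A * c / (2 - \<theta>' * c) + 2 * l / \<theta>' = c / 2 * (a + b)\<^sup>2"
  proof -
    have "\<theta>' * c = 2 * b / (a + b)" using c by (simp add: \<theta>'_def)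
    then have "2 - \<theta>' * c = 2 * a / (a + b)" using ab by (simp add: field_simps)
    then have "A * c / (2 - \<theta>' * c) = c / 2 * (a * (a + b))" using ab by (simp add: power2_eq_square)
    moreover have "2 * l / \<theta>' = c / 2 * (b * (a + b))" 
      unfolding ab(4) \<theta>'_def using ab c by (simp add: power2_eq_square)
    ultimately show ?thesis by (simp add: power2_eq_square algebra_simps)
  qed
  ultimately show thesis using that unfolding a_def b_def by blast
qed

text \<open>
  The suboptimality is dominated by the Lyapunov function, whose exponential moment at
  \<open>\<theta> / (2 * \<sigma>\<^sup>2)\<close> is known. The statement covers any \<open>\<theta>\<close> for which the step bound has rate \<open>\<rho>\<close>,
  because the risk parameter is optimised afterwards.
\<close>

lemma evar_gmm_le:
  fixes f :: "'a::euclidean_space \<Rightarrow> real" and w x :: "nat \<Rightarrow> 'w \<Rightarrow> 'a"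
  assumes mu: "0 < \<mu>" "\<mu> < L" and ok: "gmm_alpha_ok \<mu> L vartheta \<psi> \<alpha>"
    and f: "strongly_convex \<mu> f" "smooth_with L f" "is_arg_min f (\<lambda>_. True) xs"
    and \<beta>: "\<beta> = gmm_beta \<mu> vartheta \<psi> \<alpha>" and \<gamma>: "\<gamma> = gmm_gamma \<mu> vartheta \<psi> \<alpha>"
    and c: "c = \<alpha> * (vartheta + \<alpha> * L)" and s: "s = sqrt (vartheta * \<alpha> * \<mu>)"
    and x: "x = (\<lambda>k \<omega>. fst (gmm_state (gradient f) \<alpha> \<beta> \<gamma> x0 xm1 (\<lambda>i. w i \<omega>) k))"
    and M: "prob_space M" and \<sigma>: "0 < \<sigma>"
    and w_gaussian:
      "\<And>k. distributed M lborel (w (Suc k)) (\<lambda>u. ennreal (isotropic_normal_density \<sigma> u))"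
    and w_indep:
      "\<And>k. prob_space.indep_set M (generated_sigma M w {Suc k}) (generated_sigma M x {0..k})"
    and \<theta>: "0 < \<theta>" "\<theta> * c < 2" and \<rho>: "(1 - s) / (1 - \<theta> * c / 2) \<le> \<rho>" "\<rho> < 1"
  shows "evar M \<sigma> \<zeta> (\<lambda>\<omega>. f (x k \<omega>) - f xs)
    \<le> ereal (\<sigma>\<^sup>2 * (real DIM('a) / (1 - \<rho>) * c / (2 - \<theta> * c) + 2 * ln (1 / \<zeta>) / \<theta>)
        + \<rho> ^ k * lyapunov \<mu> vartheta \<alpha> f xs (x0, xm1))"
proof -
  define T where "T = \<theta> / (2 * \<sigma>\<^sup>2)"
  have T0: "0 \<le> T" using \<theta> by (simp add: T_def)
  have Tc: "T * \<sigma>\<^sup>2 * c = \<theta> * c / 2" using \<sigma> by (simp add: T_def)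
  define B where "B = real DIM('a) / 2 * (\<sigma>\<^sup>2 * c / (1 - T * \<sigma>\<^sup>2 * c)) / (1 - \<rho>)
        + \<rho> ^ k * lyapunov \<mu> vartheta \<alpha> f xs (x0, xm1)"
  have "(\<integral>\<^sup>+\<omega>. ennreal (exp (T * (f (x k \<omega>) - f xs))) \<partial>M)
      \<le> (\<integral>\<^sup>+\<omega>. ennreal (exp (T * lyapunov \<mu> vartheta \<alpha> f xs (gmm_state (gradient f) \<alpha> \<beta> \<gamma> x0 xm1 (\<lambda>i. w i \<omega>) k))) \<partial>M)"
    unfolding x using T0
    by (intro nn_integral_mono ennreal_leI)
       (simp add: mult_left_mono, metis mult_left_mono prod.collapse suboptimality_le_lyapunov)
  also have "\<dots> \<le> ennreal (exp (T * B))"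
    unfolding B_def
    by (rule gmm_exponential_moment[OF mu ok f \<beta> \<gamma> c s x M \<sigma> w_gaussian w_indep])
       (use \<theta> \<rho> T0 in \<open>simp_all add: Tc\<close>)
  finally have "entropic_risk M \<sigma> (\<lambda>\<omega>. f (x k \<omega>) - f xs) \<theta> \<le> ereal B"
    unfolding T_def by (rule entropic_risk_le[OF \<sigma> \<theta>(1)])
  then have step: "entropic_risk M \<sigma> (\<lambda>\<omega>. f (x k \<omega>) - f xs) \<theta> + ereal (2 * \<sigma>\<^sup>2 / \<theta> * ln (1 / \<zeta>))
      \<le> ereal B + ereal (2 * \<sigma>\<^sup>2 / \<theta> * ln (1 / \<zeta>))"
    by (rule add_right_mono)
  have "evar M \<sigma> \<zeta> (\<lambda>\<omega>. f (x k \<omega>) - f xs)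
      \<le> entropic_risk M \<sigma> (\<lambda>\<omega>. f (x k \<omega>) - f xs) \<theta> + ereal (2 * \<sigma>\<^sup>2 / \<theta> * ln (1 / \<zeta>))"
    unfolding evar_def using \<theta>(1) by (intro INF_lower) simp
  from order_trans[OF this step] have "evar M \<sigma> \<zeta> (\<lambda>\<omega>. f (x k \<omega>) - f xs) \<le> ereal (B + 2 * \<sigma>\<^sup>2 / \<theta> * ln (1 / \<zeta>))"
    unfolding plus_ereal.simps(1) .
  also have "B + 2 * \<sigma>\<^sup>2 / \<theta> * ln (1 / \<zeta>)
      = \<sigma>\<^sup>2 * (real DIM('a) / (1 - \<rho>) * c / (2 - \<theta> * c) + 2 * ln (1 / \<zeta>) / \<theta>)
        + \<rho> ^ k * lyapunov \<mu> vartheta \<alpha> f xs (x0, xm1)"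
  proof -
    have "\<sigma>\<^sup>2 * c / (1 - T * \<sigma>\<^sup>2 * c) = 2 * \<sigma>\<^sup>2 * c / (2 - \<theta> * c)"
      unfolding Tc using \<theta>(2) by (simp add: divide_simps)
    then show ?thesis unfolding B_def
      by (simp add: distrib_left mult.assoc mult.commute mult.left_commute)
  qed
  finally show ?thesis .
qed

theorem theorem3:
  fixes f :: "real ^ 'n \<Rightarrow> real"
    and \<mu> L \<sigma> vartheta \<psi> \<alpha> \<beta> \<gamma> \<phi> \<zeta> v \<theta> \<rho> d c E1 E2 V0 :: real
    and xs x0 xm1 :: "real ^ 'n"
    and M :: "'w measure"
    and w x :: "nat \<Rightarrow> 'w \<Rightarrow> real ^ 'n"
    and cond :: bool
    and risk :: "nat \<Rightarrow> ereal"
  assumes "0 < \<mu>" "\<mu> < L" "0 < \<sigma>"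
    and "0 < \<phi>" "\<phi> < 1" "0 < \<zeta>" "\<zeta> < 1"
    and f: "strongly_convex \<mu> f" "smooth_with L f" "is_arg_min f (\<lambda>_. True) xs"
    and \<alpha>: "gmm_alpha_ok \<mu> L vartheta \<psi> \<alpha>"
    and \<beta>: "\<beta> = gmm_beta \<mu> vartheta \<psi> \<alpha>"
    and \<gamma>: "\<gamma> = gmm_gamma \<mu> vartheta \<psi> \<alpha>"
    and x: "x = (\<lambda>k \<omega>. fst (gmm_state (gradient f) \<alpha> \<beta> \<gamma> x0 xm1 (\<lambda>i. w i \<omega>) k))"
    and "prob_space M"
    and w_gaussian:
      "\<And>k. distributed M lborel (w (Suc k)) (\<lambda>u. ennreal (isotropic_normal_density \<sigma> u))"
    and w_indep:
      "\<And>k. prob_space.indep_set M (generated_sigma M w {Suc k}) (generated_sigma M x {0..k})"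
    and v: "v = gmm_v \<mu> L vartheta \<alpha> \<beta> \<gamma>"
    and \<theta>: "\<theta> = \<phi> * gmm_theta_u \<mu> L vartheta \<alpha> v"
    and \<rho>: "\<rho> = gmm_rho \<mu> L vartheta \<alpha> v \<theta>"
    and d: "d = real CARD('n)"
    and c: "c = \<alpha> * (vartheta + \<alpha> * L)"
    and cond: "cond \<longleftrightarrow> ln (1 / \<zeta>) \<le> d / (2 * (1 - \<rho>)) * (\<theta> * c / (2 - \<theta> * c))\<^sup>2"
    and E1: "E1 = \<sigma>\<^sup>2 * c / 2 * (sqrt (d / (1 - \<rho>)) + sqrt (2 * ln (1 / \<zeta>)))\<^sup>2"
    and E2: "E2 = \<sigma>\<^sup>2 * d * c / ((1 - \<rho>) * (2 - \<theta> * c)) + 2 * \<sigma>\<^sup>2 / \<theta> * ln (1 / \<zeta>)"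
    and V0: "V0 = lyapunov \<mu> vartheta \<alpha> f xs (x0, xm1)"
    and risk: "risk = (\<lambda>k. evar M \<sigma> \<zeta> (\<lambda>\<omega>. f (x k \<omega>) - f xs))"
  shows "(cond \<longrightarrow> (\<forall>k\<ge>1. risk k \<le> ereal (E1 + \<rho> ^ k * (2 * V0)))) \<and>
         (\<not> cond \<longrightarrow> (\<forall>k\<ge>1. risk k \<le> ereal (E2 + \<rho> ^ k * (2 * V0)))) \<and>
         limsup risk \<le> ereal (if cond then E1 else E2)"
proof -
  define s A l E where "s = sqrt (vartheta * \<alpha> * \<mu>)" and "A = d / (1 - \<rho>)" and "l = ln (1 / \<zeta>)"
    and "E = (if cond then E1 else E2)"
  note mu = \<open>0 < \<mu>\<close> \<open>\<mu> < L\<close>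
  note P = gmm_parameters[OF mu \<alpha>]
  note R = gmm_rate_bounds[OF mu \<alpha> \<open>0 < \<phi>\<close> \<open>\<phi> < 1\<close> v \<theta> \<rho> c s_def]
  have c0: "0 < c" unfolding c using P mu by (intro mult_pos_pos add_pos_pos) auto
  have s1: "s < 1" using P mu by (simp add: s_def)
  have A: "0 < A" unfolding A_def d using R(4) by simp
  have l: "0 < l" unfolding l_def using \<open>0 < \<zeta>\<close> \<open>\<zeta> < 1\<close> by simp
  have V0_nonneg: "0 \<le> V0" unfolding V0 by (rule lyapunov_nonneg[OF f(3)])
  have \<rho>0: "0 \<le> \<rho>" using s1 R(2) by (intro order_trans[OF _ R(3)]) auto
  have bound: "risk k \<le> ereal (\<sigma>\<^sup>2 * (A * c / (2 - \<theta>' * c) + 2 * l / \<theta>') + \<rho> ^ k * V0)"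
    if \<theta>': "0 < \<theta>'" "\<theta>' \<le> \<theta>" for \<theta>' k
  proof -
    have le: "\<theta>' * c \<le> \<theta> * c" using \<theta>' c0 by (intro mult_right_mono) auto
    then have "(1 - s) / (1 - \<theta>' * c / 2) \<le> (1 - s) / (1 - \<theta> * c / 2)"
      using s1 R(2) by (intro divide_left_mono) auto
    then have rate: "(1 - s) / (1 - \<theta>' * c / 2) \<le> \<rho>" using R(3) by simp
    have "\<theta>' * c < 2" using le R(2) by simp
    from evar_gmm_le[OF mu \<alpha> f \<beta> \<gamma> c s_def x \<open>prob_space M\<close> \<open>0 < \<sigma>\<close> w_gaussian w_indep \<theta>'(1) this rate R(4)]
    show ?thesis by (simp add: risk A_def l_def V0 d)
  qed
  obtain \<theta>' where \<theta>': "0 < \<theta>'" "\<theta>' \<le> \<theta>" and opt: "\<sigma>\<^sup>2 * (A * c / (2 - \<theta>' * c) + 2 * l / \<theta>') = E"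
  proof (cases cond)
    case True
    then have "l \<le> A / 2 * (\<theta> * c / (2 - \<theta> * c))\<^sup>2" using cond by (simp add: l_def A_def mult.commute)
    from optimal_risk_parameter[OF A l c0 R(1,2) this] obtain \<theta>' where
      "0 < \<theta>'" "\<theta>' \<le> \<theta>" "A * c / (2 - \<theta>' * c) + 2 * l / \<theta>' = c / 2 * (sqrt A + sqrt (2 * l))\<^sup>2" .
    with True show thesis by (intro that[of \<theta>']) (simp_all add: E_def E1 A_def l_def)
  next
    case False
    then have "\<sigma>\<^sup>2 * (A * c / (2 - \<theta> * c) + 2 * l / \<theta>) = E"
      by (simp add: E_def E2 A_def l_def distrib_left mult.assoc mult.left_commute)
    with R(1) show thesis by (intro that[of \<theta>]) auto
  qed
  \<comment> \<open>doubling the initial value is harmless since it is nonnegative\<close>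
  have main: "risk k \<le> ereal (E + \<rho> ^ k * (2 * V0))" for k
  proof -
    have "0 \<le> \<rho> ^ k * V0" using \<rho>0 V0_nonneg by simp
    then have "ereal (E + \<rho> ^ k * V0) \<le> ereal (E + \<rho> ^ k * (2 * V0))"
      unfolding ereal_less_eq mult.left_commute[of _ 2] by linarith
    then show ?thesis using bound[OF \<theta>', of k] unfolding opt by (rule order_trans[rotated])
  qed
  have "(\<lambda>k. E + \<rho> ^ k * (2 * V0)) \<longlonglongrightarrow> E + 0 * (2 * V0)"
    using \<rho>0 R(4) by (intro tendsto_intros LIMSEQ_realpow_zero)
  then have "(\<lambda>k. ereal (E + \<rho> ^ k * (2 * V0))) \<longlonglongrightarrow> ereal E" by simp
  then have "limsup (\<lambda>k. ereal (E + \<rho> ^ k * (2 * V0))) = ereal E"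
    by (intro lim_imp_Limsup) simp_all
  moreover have "limsup risk \<le> limsup (\<lambda>k. ereal (E + \<rho> ^ k * (2 * V0)))"
    by (intro Limsup_mono always_eventually) (simp add: main)
  ultimately have "limsup risk \<le> ereal E" by simp
  then show ?thesis by (cases cond) (use main in \<open>simp_all add: E_def\<close>)
qed

end
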